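(* Let $\mathfrak n_{5,2}$ be the Lie algebra over $\mathbb F$ with ordered basis $\{x_1,x_2,x_3,x_4,x_5\}$ whose only nonzero brackets of basis elements (up to skew-symmetry) are $[x_4,x_3]=-x_2$, $[x_5,x_3]=-x_1$, and $[x_5,x_4]=-x_3$. Then for all $j,k,l,m,n,p,q,r,s,t\in\mathbb Z_{\ge0}$ the following identity holds in $\mathbf U(\mathfrak n_{5,2})$: $$\begin{aligned} &(x_1^jx_2^kx_3^lx_4^mx_5^n)(x_1^px_2^qx_3^rx_4^sx_5^t)\\ &=\sum_{\alpha=0}^{\min\{n,r\}}\ \sum_{\substack{\beta_1,\beta_2,\beta_3\in\mathbb Z_{\ge 0}\\ \beta_1+2\beta_2+\beta_3\le s\\ \beta_1+\beta_2+2\beta_3\le n-\alpha}}\ \sum_{\gamma=0}^{\min\{m,r-\alpha+\beta_1\}}\binom{n}{\alpha}\binom{r}{\alpha}\binom{s}{\beta_1+2\beta_2+\beta_3}\binom{n-\alpha}{\beta_1+\beta_2+2\beta_3}\binom{m}{\gamma}\binom{r-\alpha+\beta_1}{\gamma}\\ &\quad\times \frac{(\beta_1+2\beta_2+\beta_3)!\,(\beta_1+\beta_2+2\beta_3)!}{2^{\beta_2+\beta_3}\,\beta_3!\,\beta_2!\,\beta_1!}(-1)^{\alpha+\beta_1+\gamma}\alpha!\,\gamma!\; x_1^{j+p+\alpha+\beta_3}x_2^{k+q+\beta_2+\gamma}x_3^{l+r-\alpha+\beta_1-\gamma}\\ &\quad\times x_4^{m+s-\gamma-\beta_1-2\beta_2-\beta_3}x_5^{n+t-\alpha-\beta_1-\beta_2-2\beta_3}.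 \end{aligned}$$
   Context: $\mathbb F$ is $\mathbb R$ or $\mathbb C$. $\mathbf U(L)$ denotes the universal enveloping algebra of the Lie algebra $L$ (the universal unital associative $\mathbb F$-algebra with a linear map $\iota:L\to\mathbf U(L)$ satisfying $\iota([x,y])=\iota(x)\iota(y)-\iota(y)\iota(x)$). Elements of $L$ are identified with their images under $\iota$, so $xy=yx+[x,y]$ in $\mathbf U(L)$ for $x,y\in L$; powers and products of the $x_i$ are taken in $\mathbf U(L)$. *)

theory Defs
  imports
    "HOL-Algebra.Algebraic_Closure_Type"
    "HOL-Algebra.QuotRing"
    "HOL-Algebra.Module"
    "HOL-Library.Poly_Mapping"
    "HOL-Library.Product_Plus"
begin

section \<open>The ground field\<close>

text \<open>A type of this class is a field isomorphic to the reals or to the complex numbers.\<close>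

class real_or_complex = field_char_0 +
  assumes iso_real_or_complex:
    "(\<exists>f :: 'a \<Rightarrow> real. bij f \<and> (\<forall>a b. f (a + b) = f a + f b) \<and> (\<forall>a b. f (a * b) = f a * f b)) \<or>
     (\<exists>f :: 'a \<Rightarrow> complex. bij f \<and> (\<forall>a b. f (a + b) = f a + f b) \<and> (\<forall>a b. f (a * b) = f a * f b))"

instance real :: real_or_complex
  by standard (rule disjI1, rule exI[of _ id], simp)

instance complex :: real_or_complex
  by standard (rule disjI2, rule exI[of _ id], simp)


section \<open>Lie algebras\<close>

locale lie_algebra = vector_space scale
  for scale :: "'f::field \<Rightarrow> 'l::ab_group_add \<Rightarrow> 'l" +
  fixes bracket :: "'l \<Rightarrow> 'l \<Rightarrow> 'l"
  assumes bracket_linear_right: "Vector_Spaces.linear scale scale (\<lambda>y. bracket x y)"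
    and bracket_linear_left: "Vector_Spaces.linear scale scale (\<lambda>x. bracket x y)"
    and bracket_self: "bracket x x = 0"
    and jacobi: "bracket x (bracket y z) + bracket y (bracket z x) + bracket z (bracket x y) = 0"

text \<open>
  The ordered basis is the family \<open>x 1, \<dots>, x 5\<close>; the values of \<open>x\<close> at other indices are irrelevant.
\<close>

locale lie_algebra_n52 = lie_algebra scale bracket
  for scale :: "'f::field \<Rightarrow> 'l::ab_group_add \<Rightarrow> 'l" and bracket :: "'l \<Rightarrow> 'l \<Rightarrow> 'l" +
  fixes x :: "nat \<Rightarrow> 'l"
  assumes basis_inj: "inj_on x {1..5}"
    and basis_independent: "independent (x ` {1..5})"
    and basis_span: "span (x ` {1..5}) = UNIV"
    and bracket_43: "bracket (x 4) (x 3) = - x 2"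
    and bracket_53: "bracket (x 5) (x 3) = - x 1"
    and bracket_54: "bracket (x 5) (x 4) = - x 3"
    and bracket_other: "\<lbrakk>1 \<le> b; b < a; a \<le> 5; (a, b) \<notin> {(4, 3), (5, 3), (5, 4)}\<rbrakk>
                          \<Longrightarrow> bracket (x a) (x b) = 0"


section \<open>The free associative algebra on a type\<close>

datatype 'l free_monoid = Word (letters: "'l list")

instantiation free_monoid :: (type) monoid_add
begin

definition zero_free_monoid :: "'l free_monoid"
  where "zero_free_monoid = Word []"

definition plus_free_monoid :: "'l free_monoid \<Rightarrow> 'l free_monoid \<Rightarrow> 'l free_monoid"
  where "plus_free_monoid u v = Word (letters u @ letters v)"

instance
  by standard (simp_all add: zero_free_monoid_def plus_free_monoid_def)

end

text \<open>
  The type \<open>'l free_monoid \<Rightarrow>\<^sub>0 'f\<close> with its convolution product is the monoid algebra of the free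
  monoid, that is, the free unital associative algebra over \<open>'f\<close> on the set underlying \<open>'l\<close>.
\<close>

type_synonym ('f, 'l) free_alg = "'l free_monoid \<Rightarrow>\<^sub>0 'f"

definition free_gen :: "'l \<Rightarrow> ('f::field, 'l) free_alg"
  where "free_gen x = Poly_Mapping.single (Word [x]) 1"

definition free_scalar :: "'f::field \<Rightarrow> ('f, 'l) free_alg"
  where "free_scalar c = Poly_Mapping.single 0 c"

abbreviation free_ring :: "('f::field, 'l) free_alg ring"
  where "free_ring \<equiv> ring_of_type_algebra"


section \<open>The universal enveloping algebra\<close>

text \<open>
  The linearity relations turn the free algebra on the set \<open>L\<close> into the tensor algebra of the vector
  space \<open>L\<close>; the commutator relations then give the enveloping algebra.
\<close>

definition uea_relations ::
    "('f::field \<Rightarrow> 'l::ab_group_add \<Rightarrow> 'l) \<Rightarrow> ('l \<Rightarrow> 'l \<Rightarrow> 'l) \<Rightarrow> ('f, 'l) free_alg set"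
  where "uea_relations scale bracket =
      {free_gen (x + y) - (free_gen x + free_gen y) | x y. True}
    \<union> {free_gen (scale c x) - free_scalar c * free_gen x | c x. True}
    \<union> {free_gen (bracket x y) - (free_gen x * free_gen y - free_gen y * free_gen x) | x y. True}"

definition uea_ideal ::
    "('f::field \<Rightarrow> 'l::ab_group_add \<Rightarrow> 'l) \<Rightarrow> ('l \<Rightarrow> 'l \<Rightarrow> 'l) \<Rightarrow> ('f, 'l) free_alg set"
  where "uea_ideal scale bracket = Idl\<^bsub>free_ring\<^esub> (uea_relations scale bracket)"

text \<open>
  The record type \<open>module\<close> of HOL-Algebra is used only as a ring record with a scalar
  multiplication (its locale \<open>algebra\<close> is restricted to commutative algebras).
\<close>

definition UEA ::
    "('f::field \<Rightarrow> 'l::ab_group_add \<Rightarrow> 'l) \<Rightarrow> ('l \<Rightarrow> 'l \<Rightarrow> 'l) \<Rightarrow> ('f, ('f, 'l) free_alg set) module"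
  where "UEA scale bracket =
    (let I = uea_ideal scale bracket; Q = free_ring Quot I
     in ring.extend Q (module.fields (\<lambda>c u. (I +>\<^bsub>free_ring\<^esub> free_scalar c) \<otimes>\<^bsub>Q\<^esub> u)))"

definition uea_incl ::
    "('f::field \<Rightarrow> 'l::ab_group_add \<Rightarrow> 'l) \<Rightarrow> ('l \<Rightarrow> 'l \<Rightarrow> 'l) \<Rightarrow> 'l \<Rightarrow> ('f, 'l) free_alg set"
  where "uea_incl scale bracket x = uea_ideal scale bracket +>\<^bsub>free_ring\<^esub> free_gen x"


section \<open>The universal property\<close>

lemma ring_free_ring: "ring (free_ring :: ('f::field, 'l) free_alg ring)"
proof -
  have "\<exists>y. x + y = 0" for x :: "('f, 'l) free_alg"
    using add.right_inverse by blast
  then show ?thesis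
    unfolding ring_of_type_algebra_def using add.right_inverse
    by unfold_locales (auto simp: algebra_simps Units_def)
qed

lemma free_ring_simps [simp]:
  "carrier free_ring = UNIV"
  "a \<otimes>\<^bsub>free_ring\<^esub> b = a * b"
  "a \<oplus>\<^bsub>free_ring\<^esub> b = a + b"
  "\<one>\<^bsub>free_ring\<^esub> = 1"
  "\<zero>\<^bsub>free_ring\<^esub> = 0"
  by (simp_all add: ring_of_type_algebra_def)

lemma free_ring_minus [simp]: "a \<ominus>\<^bsub>free_ring\<^esub> b = a - b"
proof -
  interpret ring "free_ring :: ('f::field, 'l) free_alg ring"
    by (rule ring_free_ring)
  have "\<ominus>\<^bsub>free_ring\<^esub> b = - b"
    by (rule minus_equality) simp_all
  then show ?thesis
    by (simp add: a_minus_def)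
qed

lemma ideal_uea_ideal: "ideal (uea_ideal scale bracket) free_ring"
  unfolding uea_ideal_def by (rule ring.genideal_ideal[OF ring_free_ring]) simp

lemma uea_relations_subset: "uea_relations scale bracket \<subseteq> uea_ideal scale bracket"
  unfolding uea_ideal_def by (rule ring.genideal_self[OF ring_free_ring]) simp

definition uea_class ::
    "('f::field \<Rightarrow> 'l::ab_group_add \<Rightarrow> 'l) \<Rightarrow> ('l \<Rightarrow> 'l \<Rightarrow> 'l) \<Rightarrow> ('f, 'l) free_alg \<Rightarrow> ('f, 'l) free_alg set"
  where "uea_class scale bracket a = uea_ideal scale bracket +>\<^bsub>free_ring\<^esub> a"

lemma uea_class_eq_iff:
  "uea_class scale bracket a = uea_class scale bracket b \<longleftrightarrow> a - b \<in> uea_ideal scale bracket"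
proof -
  interpret ideal "uea_ideal scale bracket" free_ring
    by (rule ideal_uea_ideal)
  show ?thesis
    using quotient_eq_iff_same_a_r_cos[OF ideal_uea_ideal, of a b scale bracket]
    by (simp add: uea_class_def)
qed

lemma carrier_UEA: "carrier (UEA scale bracket) = range (uea_class scale bracket)"
  by (auto simp: UEA_def Let_def ring.defs module.defs FactRing_def A_RCOSETS_def'
      uea_class_def a_r_coset_def')

lemma UEA_simps:
  "uea_class scale bracket a \<otimes>\<^bsub>UEA scale bracket\<^esub> uea_class scale bracket b = uea_class scale bracket (a * b)"
  "uea_class scale bracket a \<oplus>\<^bsub>UEA scale bracket\<^esub> uea_class scale bracket b = uea_class scale bracket (a + b)"
  "\<one>\<^bsub>UEA scale bracket\<^esub> = uea_class scale bracket 1"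
  "\<zero>\<^bsub>UEA scale bracket\<^esub> = uea_class scale bracket 0"
  "c \<odot>\<^bsub>UEA scale bracket\<^esub> uea_class scale bracket a = uea_class scale bracket (free_scalar c * a)"
  "uea_incl scale bracket x = uea_class scale bracket (free_gen x)"
proof -
  interpret ideal "uea_ideal scale bracket" free_ring
    by (rule ideal_uea_ideal)
  show
    "uea_class scale bracket a \<otimes>\<^bsub>UEA scale bracket\<^esub> uea_class scale bracket b = uea_class scale bracket (a * b)"
    "uea_class scale bracket a \<oplus>\<^bsub>UEA scale bracket\<^esub> uea_class scale bracket b = uea_class scale bracket (a + b)"
    "\<one>\<^bsub>UEA scale bracket\<^esub> = uea_class scale bracket 1"
    "\<zero>\<^bsub>UEA scale bracket\<^esub> = uea_class scale bracket 0"
    "c \<odot>\<^bsub>UEA scale bracket\<^esub> uea_class scale bracket a = uea_class scale bracket (free_scalar c * a)"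
    "uea_incl scale bracket x = uea_class scale bracket (free_gen x)"
    using rcoset_mult_add[of a b] rcoset_mult_add[of "free_scalar c" a] a_rcos_sum[of a b]
      a_rcos_zero[OF ideal_uea_ideal, of 0 scale bracket]
      additive_subgroup.zero_closed[OF is_additive_subgroup]
    by (simp_all add: UEA_def Let_def ring.defs module.defs FactRing_def uea_class_def uea_incl_def)
qed

lemma ring_UEA: "ring (UEA scale bracket)"
proof (rule ringI)
  have inv: "\<exists>v\<in>range (uea_class scale bracket).
      v \<oplus>\<^bsub>UEA scale bracket\<^esub> uea_class scale bracket a = uea_class scale bracket 0" for a
    by (rule bexI[of _ "uea_class scale bracket (- a)"]) (simp_all add: UEA_simps)
  show "abelian_group (UEA scale bracket)"
    by (rule abelian_groupI) (use inv in \<open>auto simp: carrier_UEA UEA_simps ac_simps\<close>)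
  show "monoid (UEA scale bracket)"
    by (rule monoidI) (auto simp: carrier_UEA UEA_simps mult.assoc)
qed (auto simp: carrier_UEA UEA_simps distrib_left distrib_right)

lemma uea_incl_add:
  "uea_incl scale bracket (x + y) =
   uea_incl scale bracket x \<oplus>\<^bsub>UEA scale bracket\<^esub> uea_incl scale bracket y"
  unfolding UEA_simps uea_class_eq_iff
  by (rule subsetD[OF uea_relations_subset]) (auto simp: uea_relations_def)

lemma uea_incl_scale:
  "uea_incl scale bracket (scale c x) = c \<odot>\<^bsub>UEA scale bracket\<^esub> uea_incl scale bracket x"
  unfolding UEA_simps uea_class_eq_iff
  by (rule subsetD[OF uea_relations_subset]) (auto simp: uea_relations_def)

lemma uea_incl_bracket:
  "uea_incl scale bracket (bracket x y) =
   uea_incl scale bracket x \<otimes>\<^bsub>UEA scale bracket\<^esub> uea_incl scale bracket y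
   \<ominus>\<^bsub>UEA scale bracket\<^esub> uea_incl scale bracket y \<otimes>\<^bsub>UEA scale bracket\<^esub> uea_incl scale bracket x"
proof -
  interpret ring "UEA scale bracket"
    by (rule ring_UEA)
  have "\<ominus>\<^bsub>UEA scale bracket\<^esub> uea_class scale bracket a = uea_class scale bracket (- a)" for a
    by (rule minus_equality) (simp_all add: UEA_simps carrier_UEA)
  moreover have "free_gen (bracket x y) - (free_gen x * free_gen y - free_gen y * free_gen x)
      \<in> uea_ideal scale bracket"
    by (rule subsetD[OF uea_relations_subset]) (auto simp: uea_relations_def)
  ultimately show ?thesis
    by (simp add: a_minus_def UEA_simps uea_class_eq_iff)
qed

lemma free_alg_induct [case_names zero single add]:
  fixes a :: "('f::field, 'l) free_alg"
  assumes "P 0" and "\<And>w c. P (Poly_Mapping.single w c)" and "\<And>a b. P a \<Longrightarrow> P b \<Longrightarrow> P (a + b)"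
  shows "P a"
proof (induction a rule: update_induct)
  case const
  show ?case by (rule assms(1))
next
  case (update a w c)
  have "Poly_Mapping.update w c a = Poly_Mapping.single w c + a"
    using update.hyps
    by (intro poly_mapping_eqI) (auto simp: lookup_update lookup_add lookup_single in_keys_iff when_def)
  then show ?case
    using update.IH assms by simp
qed

definition free_lift :: "('f::field \<Rightarrow> 'a::ring_1) \<Rightarrow> ('l \<Rightarrow> 'a) \<Rightarrow> ('f, 'l) free_alg \<Rightarrow> 'a"
  where "free_lift \<sigma> \<phi> a =
    (\<Sum>w\<in>Poly_Mapping.keys a. \<sigma> (Poly_Mapping.lookup a w) * prod_list (map \<phi> (letters w)))"

text \<open>
  An algebra over \<open>'f\<close> is presented here by a ring \<open>'a\<close> with a unital ring homomorphism \<open>\<sigma>\<close>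
  from \<open>'f\<close> into its centre.
\<close>

theorem UEA_universal:
  fixes scale :: "'f::field \<Rightarrow> 'l::ab_group_add \<Rightarrow> 'l"
    and \<sigma> :: "'f \<Rightarrow> 'a::ring_1" and \<phi> :: "'l \<Rightarrow> 'a"
  assumes \<sigma>: "\<sigma> 1 = 1" "\<And>a b. \<sigma> (a + b) = \<sigma> a + \<sigma> b" "\<And>a b. \<sigma> (a * b) = \<sigma> a * \<sigma> b"
    and central: "\<And>a z. \<sigma> a * z = z * \<sigma> a"
    and \<phi>: "\<And>x y. \<phi> (x + y) = \<phi> x + \<phi> y" "\<And>c x. \<phi> (scale c x) = \<sigma> c * \<phi> x"
      "\<And>x y. \<phi> (bracket x y) = \<phi> x * \<phi> y - \<phi> y * \<phi> x"
  defines "is_hom h \<equiv> h \<in> ring_hom (UEA scale bracket) (ring_of_type_algebra :: 'a ring)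
      \<and> (\<forall>c. \<forall>u\<in>carrier (UEA scale bracket). h (c \<odot>\<^bsub>UEA scale bracket\<^esub> u) = \<sigma> c * h u)
      \<and> (\<forall>x. h (uea_incl scale bracket x) = \<phi> x)"
  shows "\<exists>h. is_hom h"
    and "\<lbrakk>is_hom h; is_hom h'; u \<in> carrier (UEA scale bracket)\<rbrakk> \<Longrightarrow> h u = h' u"
proof -
  let ?F = "free_lift \<sigma> \<phi>" and ?C = "uea_class scale bracket" and ?I = "uea_ideal scale bracket"
  have \<sigma>0: "\<sigma> 0 = 0"
    using \<sigma>(2)[of 0 0] by simp
  have single: "?F (Poly_Mapping.single w c) = \<sigma> c * prod_list (map \<phi> (letters w))" for w c
    by (cases "c = 0") (simp_all add: free_lift_def \<sigma>0)
  have sup: "?F a = (\<Sum>w\<in>S. \<sigma> (Poly_Mapping.lookup a w) * prod_list (map \<phi> (letters w)))"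
    if "finite S" "Poly_Mapping.keys a \<subseteq> S" for a S
    unfolding free_lift_def using that
    by (intro sum.mono_neutral_left) (auto simp: in_keys_iff \<sigma>0)
  have F_add: "?F (a + b) = ?F a + ?F b" for a b
  proof -
    let ?S = "Poly_Mapping.keys a \<union> Poly_Mapping.keys b"
    show ?thesis
      using keys_add[of a b]
      by (simp add: sup[of ?S] lookup_add \<sigma> distrib_right sum.distrib)
  qed
  have F_zero: "?F 0 = 0"
    by (simp add: free_lift_def)
  have F_uminus: "?F (- a) = - ?F a" for a
    using F_add[of a "- a"] F_zero by (simp add: eq_neg_iff_add_eq_0 add.commute)
  have diff: "?F (a - b) = ?F a - ?F b" for a b
    using F_add[of a "- b"] by (simp add: F_uminus)
  have F_mult_single: "?F (Poly_Mapping.single u c * Poly_Mapping.single v d)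
      = ?F (Poly_Mapping.single u c) * ?F (Poly_Mapping.single v d)" for u v c d
  proof -
    have "?F (Poly_Mapping.single u c * Poly_Mapping.single v d)
        = \<sigma> c * \<sigma> d * (prod_list (map \<phi> (letters u)) * prod_list (map \<phi> (letters v)))"
      by (simp add: mult_single single plus_free_monoid_def \<sigma>)
    also have "\<dots> = \<sigma> c * (\<sigma> d * prod_list (map \<phi> (letters u))) * prod_list (map \<phi> (letters v))"
      by (simp add: mult.assoc)
    also have "\<sigma> d * prod_list (map \<phi> (letters u)) = prod_list (map \<phi> (letters u)) * \<sigma> d"
      by (rule central)
    finally show ?thesis
      by (simp add: single mult.assoc)
  qed
  have mult1: "?F (Poly_Mapping.single u c * b) = ?F (Poly_Mapping.single u c) * ?F b" for u c b
    by (induction b rule: free_alg_induct) (simp_all add: F_zero F_mult_single distrib_left F_add)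
  have mult: "?F (a * b) = ?F a * ?F b" for a b
    by (induction a rule: free_alg_induct) (simp_all add: F_zero mult1 distrib_right F_add)
  have scalar: "?F (free_scalar c) = \<sigma> c" for c
    by (simp add: free_scalar_def single zero_free_monoid_def)
  have gen: "?F (free_gen x) = \<phi> x" for x
    by (simp add: free_gen_def single \<sigma>)
  have one: "?F 1 = 1"
    using scalar[of 1] by (simp add: free_scalar_def \<sigma>)
  have "ideal {a. ?F a = 0} free_ring"
  proof (rule idealI[OF ring_free_ring])
    interpret ring "free_ring :: ('f, 'l) free_alg ring"
      by (rule ring_free_ring)
    have inv: "\<ominus>\<^bsub>free_ring\<^esub> b = - b" for b :: "('f, 'l) free_alg"
      by (rule minus_equality) simp_all
    show "subgroup {a. ?F a = 0} (add_monoid free_ring)"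
    proof (rule add.subgroupI)
      have "0 \<in> {a. ?F a = 0}"
        by (simp add: F_zero)
      then show "{a. ?F a = 0} \<noteq> {}"
        by blast
    qed (simp_all add: F_add F_uminus inv flip: a_inv_def)
  qed (simp_all add: mult)
  moreover have "uea_relations scale bracket \<subseteq> {a. ?F a = 0}"
    by (auto simp: uea_relations_def diff F_add mult gen scalar \<phi>)
  ultimately have I: "?I \<subseteq> {a. ?F a = 0}"
    unfolding uea_ideal_def by (rule ring.genideal_minimal[OF ring_free_ring])
  have welldef: "?F (SOME b. ?C b = ?C a) = ?F a" for a
  proof -
    have "?C (SOME b. ?C b = ?C a) = ?C a"
      by (rule someI[of "\<lambda>b. ?C b = ?C a" a]) simp
    then have "?F ((SOME b. ?C b = ?C a) - a) = 0"
      using I by (auto simp: uea_class_eq_iff)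
    then show ?thesis
      by (simp add: diff)
  qed
  have "is_hom (\<lambda>u. ?F (SOME b. ?C b = u))"
    unfolding is_hom_def
  proof (intro conjI allI ballI)
    show "(\<lambda>u. ?F (SOME b. ?C b = u)) \<in> ring_hom (UEA scale bracket) (ring_of_type_algebra :: 'a ring)"
      by (rule ring_hom_memI)
        (auto simp only: carrier_UEA UEA_simps welldef mult F_add one ring_of_type_algebra_def
          partial_object.simps monoid.simps ring.simps UNIV_I)
  next
    fix c u
    assume "u \<in> carrier (UEA scale bracket)"
    then show "?F (SOME b. ?C b = c \<odot>\<^bsub>UEA scale bracket\<^esub> u) = \<sigma> c * ?F (SOME b. ?C b = u)"
      by (auto simp only: carrier_UEA UEA_simps welldef mult scalar)
  next
    fix x
    show "?F (SOME b. ?C b = uea_incl scale bracket x) = \<phi> x"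
      by (simp only: UEA_simps welldef gen)
  qed
  then show "\<exists>h. is_hom h"
    by (rule exI[where P = is_hom])

  assume h: "is_hom h" and h': "is_hom h'" and u: "u \<in> carrier (UEA scale bracket)"
  have hC: "g (?C (a * b)) = g (?C a) * g (?C b)" "g (?C (a + b)) = g (?C a) + g (?C b)"
    "g (?C (free_scalar c * a)) = \<sigma> c * g (?C a)" "g (?C (free_gen x)) = \<phi> x" "g (?C 1) = 1"
    if g: "is_hom g" for g a b c x
  proof -
    have g_hom: "g \<in> ring_hom (UEA scale bracket) (ring_of_type_algebra :: 'a ring)"
      using g by (simp add: is_hom_def)
    have car: "?C d \<in> carrier (UEA scale bracket)" for d
      by (simp add: carrier_UEA)
    show "g (?C (a * b)) = g (?C a) * g (?C b)"
      using ring_hom_mult[OF g_hom car car, of a b] by (simp add: UEA_simps ring_of_type_algebra_def)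
    show "g (?C (a + b)) = g (?C a) + g (?C b)"
      using ring_hom_add[OF g_hom car car, of a b] by (simp add: UEA_simps ring_of_type_algebra_def)
    show "g (?C 1) = 1"
      using ring_hom_one[OF g_hom] by (simp add: UEA_simps ring_of_type_algebra_def)
    have "g (c \<odot>\<^bsub>UEA scale bracket\<^esub> ?C a) = \<sigma> c * g (?C a)"
      using g car[of a] unfolding is_hom_def by blast
    then show "g (?C (free_scalar c * a)) = \<sigma> c * g (?C a)"
      by (simp only: UEA_simps)
    have "g (uea_incl scale bracket x) = \<phi> x"
      using g unfolding is_hom_def by blast
    then show "g (?C (free_gen x)) = \<phi> x"
      by (simp only: UEA_simps)
  qed
  have word: "g (?C (Poly_Mapping.single w c)) = \<sigma> c * prod_list (map \<phi> (letters w))"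
    if g: "is_hom g" for g w c
  proof -
    have 1: "g (?C (Poly_Mapping.single (Word xs) 1)) = prod_list (map \<phi> xs)" for xs
    proof (induction xs)
      case Nil
      then show ?case
        using hC(5)[OF g] by (simp flip: zero_free_monoid_def)
    next
      case (Cons x xs)
      have "Poly_Mapping.single (Word (x # xs)) 1 = free_gen x * Poly_Mapping.single (Word xs) (1::'f)"
        by (simp add: free_gen_def mult_single plus_free_monoid_def)
      then show ?case
        using Cons by (simp add: hC[OF g])
    qed
    have "Poly_Mapping.single w c = free_scalar c * Poly_Mapping.single w 1"
      by (simp add: free_scalar_def mult_single)
    then have "g (?C (Poly_Mapping.single w c)) = \<sigma> c * g (?C (Poly_Mapping.single w 1))"
      by (simp only: hC(3)[OF g])
    then show ?thesis
      using 1[of "letters w"] by simp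
  qed
  have "h (?C a) = h' (?C a)" for a
  proof (induction a rule: free_alg_induct)
    case zero
    show ?case
      using word[OF h, of 0 0] word[OF h', of 0 0] by simp
  next
    case (single w c)
    show ?case
      by (simp only: word[OF h] word[OF h'])
  next
    case (add a b)
    then show ?case
      by (simp only: hC(2)[OF h] hC(2)[OF h'])
  qed
  then show "h u = h' u"
    using u by (auto simp: carrier_UEA)
qed


section \<open>A model of the Lie algebra\<close>

definition n52_scale :: "'f::field \<Rightarrow> 'f \<times> 'f \<times> 'f \<times> 'f \<times> 'f \<Rightarrow> 'f \<times> 'f \<times> 'f \<times> 'f \<times> 'f"
  where "n52_scale c = (\<lambda>(a1, a2, a3, a4, a5). (c * a1, c * a2, c * a3, c * a4, c * a5))"

definition n52_bracket ::
    "'f::field \<times> 'f \<times> 'f \<times> 'f \<times> 'f \<Rightarrow> 'f \<times> 'f \<times> 'f \<times> 'f \<times> 'f \<Rightarrow> 'f \<times> 'f \<times> 'f \<times> 'f \<times> 'f"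
  where "n52_bracket = (\<lambda>(a1, a2, a3, a4, a5) (b1, b2, b3, b4, b5).
    (a3 * b5 - a5 * b3, a3 * b4 - a4 * b3, a4 * b5 - a5 * b4, 0, 0))"

definition n52_basis :: "nat \<Rightarrow> 'f::field \<times> 'f \<times> 'f \<times> 'f \<times> 'f"
  where "n52_basis i = (of_bool (i = 1), of_bool (i = 2), of_bool (i = 3), of_bool (i = 4), of_bool (i = 5))"

theorem lie_algebra_n52_model:
  "lie_algebra_n52 (n52_scale :: 'f::field \<Rightarrow> _) n52_bracket n52_basis"
proof -
  interpret vector_space "n52_scale :: 'f \<Rightarrow> _"
    by unfold_locales (auto simp: n52_scale_def algebra_simps)
  have idx: "{1..5} = {1, 2, 3, 4, 5::nat}"
    by auto
  have inj: "inj_on (n52_basis :: nat \<Rightarrow> 'f \<times> 'f \<times> 'f \<times> 'f \<times> 'f) {1..5}"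
    unfolding idx by (auto simp: inj_on_def n52_basis_def)
  have comb: "(\<Sum>i\<in>{1..5}. n52_scale (c i) (n52_basis i)) = (c 1, c 2, c 3, c 4, c 5)" for c :: "nat \<Rightarrow> 'f"
    unfolding idx by (simp add: n52_scale_def n52_basis_def)
  show ?thesis
  proof (intro lie_algebra_n52.intro lie_algebra.intro lie_algebra_axioms.intro
      lie_algebra_n52_axioms.intro)
    show "vector_space (n52_scale :: 'f \<Rightarrow> _)" ..
    show "Vector_Spaces.linear n52_scale n52_scale (\<lambda>y. n52_bracket x y)" for x :: "'f \<times> 'f \<times> 'f \<times> 'f \<times> 'f"
      by unfold_locales (auto simp: n52_scale_def n52_bracket_def algebra_simps split: prod.splits)
    show "Vector_Spaces.linear n52_scale n52_scale (\<lambda>x. n52_bracket x y)" for y :: "'f \<times> 'f \<times> 'f \<times> 'f \<times> 'f"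
      by unfold_locales (auto simp: n52_scale_def n52_bracket_def algebra_simps split: prod.splits)
    show "n52_bracket x x = 0" for x :: "'f \<times> 'f \<times> 'f \<times> 'f \<times> 'f"
      by (auto simp: n52_bracket_def zero_prod_def algebra_simps split: prod.splits)
    show "n52_bracket x (n52_bracket y z) + n52_bracket y (n52_bracket z x)
        + n52_bracket z (n52_bracket x y) = 0" for x y z :: "'f \<times> 'f \<times> 'f \<times> 'f \<times> 'f"
      by (auto simp: n52_bracket_def zero_prod_def algebra_simps split: prod.splits)
    show "inj_on (n52_basis :: nat \<Rightarrow> 'f \<times> 'f \<times> 'f \<times> 'f \<times> 'f) {1..5}"
      by (rule inj)
    show "independent (n52_basis ` {1..5} :: ('f \<times> 'f \<times> 'f \<times> 'f \<times> 'f) set)"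
    proof (rule independent_if_scalars_zero)
      fix f :: "'f \<times> 'f \<times> 'f \<times> 'f \<times> 'f \<Rightarrow> 'f" and v :: "'f \<times> 'f \<times> 'f \<times> 'f \<times> 'f"
      assume 0: "(\<Sum>v\<in>n52_basis ` {1..5}. n52_scale (f v) v) = 0" and v: "v \<in> n52_basis ` {1..5}"
      have "(f (n52_basis 1), f (n52_basis 2), f (n52_basis 3), f (n52_basis 4), f (n52_basis 5)) = 0"
        using 0 unfolding sum.reindex[OF inj] o_def comb .
      then show "f v = 0"
        using v unfolding idx by (auto simp: zero_prod_def)
    qed simp
    show "span (n52_basis ` {1..5} :: ('f \<times> 'f \<times> 'f \<times> 'f \<times> 'f) set) = UNIV"
    proof -
      have "(a1, a2, a3, a4, a5) \<in> span (n52_basis ` {1..5})" for a1 a2 a3 a4 a5 :: 'f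
      proof -
        have "(\<Sum>i\<in>{1..5}. n52_scale ([0, a1, a2, a3, a4, a5] ! i) (n52_basis i)) \<in> span (n52_basis ` {1..5})"
          by (intro span_sum span_scale span_base) auto
        then show ?thesis
          unfolding comb by simp
      qed
      then show ?thesis
        by auto
    qed
    fix a b :: nat
    assume "1 \<le> b" "b < a" "a \<le> 5" "(a, b) \<notin> {(4, 3), (5, 3), (5, 4)}"
    then consider "b = 1" | "b = 2" | "a = 1" | "a = 2"
      by force
    then show "n52_bracket (n52_basis a) (n52_basis b) = (0 :: 'f \<times> 'f \<times> 'f \<times> 'f \<times> 'f)"
      using \<open>b < a\<close> by cases (simp_all add: n52_bracket_def n52_basis_def zero_prod_def)
  qed (simp_all add: n52_bracket_def n52_basis_def)
qed

end

theory Submission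
  imports Defs
begin

text \<open>
  The elements \<open>x\<^sub>1\<close> and \<open>x\<^sub>2\<close> are central in the enveloping algebra, so only \<open>x\<^sub>3\<close>, \<open>x\<^sub>4\<close> and \<open>x\<^sub>5\<close>
  have to be put in order. In \<open>x\<^sub>3\<^sup>l x\<^sub>4\<^sup>m x\<^sub>5\<^sup>n x\<^sub>3\<^sup>r x\<^sub>4\<^sup>s x\<^sub>5\<^sup>t\<close> this takes three reorderings, one for each
  summation of the formula:

  \<^item> \<open>x\<^sub>5\<^sup>n x\<^sub>3\<^sup>r\<close>, where \<open>x\<^sub>5\<close> and \<open>x\<^sub>3\<close> commute up to the central \<open>x\<^sub>1\<close> (index \<open>\<alpha>\<close>);
  \<^item> \<open>x\<^sub>5\<close> to the power \<open>n - \<alpha>\<close> times \<open>x\<^sub>4\<^sup>s\<close> (indices \<open>\<beta>\<^sub>1\<close>, \<open>\<beta>\<^sub>2\<close>, \<open>\<beta>\<^sub>3\<close>);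
  \<^item> \<open>x\<^sub>4\<^sup>m\<close> times \<open>x\<^sub>3\<close> to the power \<open>r - \<alpha> + \<beta>\<^sub>1\<close>, where \<open>x\<^sub>4\<close> and \<open>x\<^sub>3\<close> commute up to the central
    \<open>x\<^sub>2\<close> (index \<open>\<gamma>\<close>).

  The first and the third are the Heisenberg relation (\<open>power_mult_power_commutator\<close>). The second
  (\<open>power_x5_mult_power_x4\<close>) carries the difficulty. Its formula can be read off from
  \<open>exp(v x\<^sub>5) exp(u x\<^sub>4) = exp(u (x\<^sub>4 - v x\<^sub>3 + v\<^sup>2/2 x\<^sub>1)) exp(v x\<^sub>5)\<close> and, since \<open>[x\<^sub>4, x\<^sub>3] = -x\<^sub>2\<close> is central,
  \<open>exp(u x\<^sub>4 - u v x\<^sub>3) = exp(-u v x\<^sub>3) exp(u x\<^sub>4) exp(u\<^sup>2 v/2 x\<^sub>2)\<close>: the indices count the factors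
  \<open>-u v x\<^sub>3\<close>, \<open>u\<^sup>2 v/2 x\<^sub>2\<close> and \<open>u v\<^sup>2/2 x\<^sub>1\<close>. The proof avoids power series: it is an induction on the exponent
  of \<open>x\<^sub>5\<close>, in which the commutator of \<open>x\<^sub>5\<close> with an ordered monomial has three terms, and these account
  for the three summands in the recursion of the coefficients.

  All this is a computation in an arbitrary associative algebra whose elements satisfy the
  relations of the basis. It is carried out in a type of a ring class, where sums, powers and the
  simplifier are at hand. The enveloping algebra, which is a ring on a carrier set that depends on
  the bracket, is reached as a component of such a type: the product of all enveloping algebras
  over the given types is a ring on a whole type, and the projection to a component preserves sums,
  products, powers and scalar multiples.
\<close>


section \<open>Reordering powers in an associative algebra\<close>

text \<open>
  The sort \<open>{ring, monoid_mult}\<close> is that of unital rings in which \<open>0 = 1\<close> is possible. With it, the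
  product of the enveloping algebras becomes an instance without a proof that they are nontrivial.
\<close>

locale assoc_algebra = vector_space scale
  for scale :: "'f::field_char_0 \<Rightarrow> 'a::{ring, monoid_mult} \<Rightarrow> 'a" (infixr "*s" 75) +
  assumes scale_mult_left [simp]: "(c *s a) * b = c *s (a * b)"
    and mult_scale_right [simp]: "a * (c *s b) = c *s (a * b)"

text \<open>
  Index shifts of sums over the fixed range \<open>{..M}\<close>: the coefficients below vanish outside the range
  of summation, so that terms moved from one index to the next neither enter nor leave it.
\<close>

lemma sum_shift:
  fixes g :: "nat \<Rightarrow> 'a::comm_monoid_add"
  assumes "g 0 = 0" and "g (Suc M) = 0"
  shows "(\<Sum>i\<le>M. g (Suc i)) = (\<Sum>i\<le>M. g i)"
  using assms sum.atMost_Suc_shift[of g M] by simp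

lemma power_commute:
  fixes a b :: "'a::monoid_mult"
  assumes "a * b = b * a"
  shows "a ^ i * b ^ j = b ^ j * a ^ i"
proof -
  have 1: "a ^ i * b = b * a ^ i" for i
    by (induction i) (simp_all add: assms mult.assoc, metis assms mult.assoc)
  show ?thesis
    by (induction j) (simp_all add: mult.assoc, metis 1 mult.assoc)
qed

lemma power_left_merge:
  fixes a u :: "'a::monoid_mult"
  shows "a ^ i * (a ^ h * u) = a ^ (i + h) * u"
  by (simp add: power_add mult.assoc)

text \<open>
  The falling factorial \<open>n (n - 1) \<dots> (n - i + 1)\<close>. This form makes its vanishing for \<open>n < i\<close> evident and
  matches the binomial coefficients and factorials of the formula.
\<close>

definition falling :: "nat \<Rightarrow> nat \<Rightarrow> 'f::field_char_0"
  where "falling n i = of_nat (n choose i) * fact i"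

lemma falling_0 [simp]: "falling n 0 = 1"
  by (simp add: falling_def)

lemma falling_eq_0 [simp]: "n < i \<Longrightarrow> falling n i = 0"
  by (simp add: falling_def)

lemma Suc_times_choose_Suc:
  "(of_nat (Suc i) * of_nat (n choose Suc i) :: 'f::semiring_1) = of_nat (n - i) * of_nat (n choose i)"
proof -
  have "Suc i * (n choose Suc i) = (n - i) * (n choose i)"
    using binomial_absorb_comp[of n i] binomial_absorption[of i n]
    by (cases n) (simp_all add: Suc_times_binomial_eq binomial_absorb_comp algebra_simps)
  then show ?thesis
    unfolding of_nat_mult[symmetric] by (rule arg_cong)
qed

lemma falling_Suc_right: "(falling n (Suc i) :: 'f::field_char_0) = of_nat (n - i) * falling n i"
proof -
  have "(falling n (Suc i) :: 'f) = (of_nat (Suc i) * of_nat (n choose Suc i)) * fact i"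
    by (simp add: falling_def algebra_simps)
  then show ?thesis
    by (simp only: Suc_times_choose_Suc falling_def mult.assoc)
qed

lemma falling_Suc_left: "(falling (Suc n) i :: 'f::field_char_0) = falling n i + of_nat i * falling n (i - 1)"
  by (cases i) (simp_all add: falling_def algebra_simps)

context assoc_algebra
begin

lemma mult_power_commutator:
  assumes "b * a = a * b - z" and "z * a = a * z"
  shows "b * a ^ r = a ^ r * b - of_nat r *s (z * a ^ (r - 1))"
proof (induction r)
  case (Suc r)
  have z: "a * (z * a ^ i) = z * a ^ Suc i" for i
    by (metis assms(2) mult.assoc power_Suc)
  have "b * a ^ Suc r = a * (b * a ^ r) - z * a ^ r"
    using assms(1) by (simp add: left_diff_distrib flip: mult.assoc)
  also have "\<dots> = a ^ Suc r * b - (of_nat r *s (a * (z * a ^ (r - 1))) + z * a ^ r)"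
    by (simp add: Suc right_diff_distrib mult.assoc)
  also have "of_nat r *s (a * (z * a ^ (r - 1))) = of_nat r *s (z * a ^ r)"
    by (cases r) (simp_all only: z, simp_all)
  finally show ?case
    by (simp add: scale_left_distrib add.commute)
qed simp

text \<open>
  In an induction on \<open>n\<close>, the new factor \<open>b\<close> either passes \<open>a ^ (r - \<alpha>)\<close> unchanged or trades one of
  these \<open>a\<close> for \<open>- z\<close>; this moves the term from index \<open>\<alpha>\<close> to \<open>Suc \<alpha>\<close> and matches the recursion
  \<open>falling_Suc_left\<close> of the coefficients.
\<close>

lemma power_mult_power_commutator:
  assumes ba: "b * a = a * b - z" and za: "z * a = a * z" and zb: "z * b = b * z"
  shows "b ^ n * a ^ r =
    (\<Sum>\<alpha>\<in>{0..min n r}. (of_nat (n choose \<alpha>) * of_nat (r choose \<alpha>) * (-1) ^ \<alpha> * fact \<alpha>)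
        *s (z ^ \<alpha> * a ^ (r - \<alpha>) * b ^ (n - \<alpha>)))"
proof -
  define w :: "nat \<Rightarrow> nat \<Rightarrow> 'f" where "w n \<alpha> = (-1) ^ \<alpha> * of_nat (r choose \<alpha>) * falling n \<alpha>" for n \<alpha>
  define E where "E n \<alpha> = z ^ \<alpha> * a ^ (r - \<alpha>) * b ^ (n - \<alpha>)" for n \<alpha>
  \<comment> \<open>The part of \<open>w (Suc n) \<alpha>\<close> that moving one more \<open>b\<close> to the right adds to \<open>w n \<alpha>\<close>.\<close>
  define P :: "nat \<Rightarrow> nat \<Rightarrow> 'f"
    where "P n \<alpha> = (-1) ^ \<alpha> * of_nat (r choose \<alpha>) * (of_nat \<alpha> * falling n (\<alpha> - 1))" for n \<alpha>
  have bE: "w n \<alpha> *s (b * E n \<alpha>) = w n \<alpha> *s E (Suc n) \<alpha> + P n (Suc \<alpha>) *s E (Suc n) (Suc \<alpha>)" for n \<alpha>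
  proof (cases "\<alpha> \<le> n")
    case True
    have zz: "z * (z ^ \<alpha> * u) = z ^ \<alpha> * (z * u)" for u
      by (metis mult.assoc power_commutes)
    have "b * E n \<alpha> = z ^ \<alpha> * (b * a ^ (r - \<alpha>)) * b ^ (n - \<alpha>)"
      using power_commute[OF zb, of \<alpha> 1] by (simp add: E_def flip: mult.assoc)
    also have "\<dots> = E (Suc n) \<alpha> - of_nat (r - \<alpha>) *s E (Suc n) (Suc \<alpha>)"
      using True
      by (simp add: mult_power_commutator[OF ba za] E_def algebra_simps Suc_diff_le zz)
    finally have "b * E n \<alpha> = E (Suc n) \<alpha> - of_nat (r - \<alpha>) *s E (Suc n) (Suc \<alpha>)" .
    moreover have "P n (Suc \<alpha>) = - of_nat (r - \<alpha>) * w n \<alpha>"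
    proof -
      have "P n (Suc \<alpha>) = - ((-1) ^ \<alpha> * (of_nat (Suc \<alpha>) * of_nat (r choose Suc \<alpha>)) * falling n \<alpha>)"
        by (simp add: P_def algebra_simps)
      then show ?thesis
        unfolding Suc_times_choose_Suc by (simp add: w_def)
    qed
    ultimately show ?thesis
      by (simp add: scale_right_diff_distrib mult.commute)
  qed (simp add: w_def P_def)
  have "b ^ n * a ^ r = (\<Sum>\<alpha>\<le>r. w n \<alpha> *s E n \<alpha>)"
  proof (induction n)
    case 0
    have "(\<Sum>\<alpha>\<le>r. w 0 \<alpha> *s E 0 \<alpha>) = (\<Sum>\<alpha>\<in>{0}. w 0 \<alpha> *s E 0 \<alpha>)"
      by (rule sum.mono_neutral_right) (auto simp: w_def)
    then show ?case
      by (simp add: w_def E_def)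
  next
    case (Suc n)
    have "b ^ Suc n * a ^ r = (\<Sum>\<alpha>\<le>r. w n \<alpha> *s (b * E n \<alpha>))"
      by (simp add: mult.assoc Suc sum_distrib_left)
    also have "\<dots> = (\<Sum>\<alpha>\<le>r. w n \<alpha> *s E (Suc n) \<alpha>) + (\<Sum>\<alpha>\<le>r. P n (Suc \<alpha>) *s E (Suc n) (Suc \<alpha>))"
      by (simp add: bE sum.distrib)
    also have "(\<Sum>\<alpha>\<le>r. P n (Suc \<alpha>) *s E (Suc n) (Suc \<alpha>)) = (\<Sum>\<alpha>\<le>r. P n \<alpha> *s E (Suc n) \<alpha>)"
      by (rule sum_shift) (simp_all add: P_def)
    also have "(\<Sum>\<alpha>\<le>r. w n \<alpha> *s E (Suc n) \<alpha>) + \<dots> = (\<Sum>\<alpha>\<le>r. w (Suc n) \<alpha> *s E (Suc n) \<alpha>)"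
      by (simp add: w_def P_def falling_Suc_left algebra_simps flip: sum.distrib scale_left_distrib)
    finally show ?case .
  qed
  also have "\<dots> = (\<Sum>\<alpha>\<in>{0..min n r}. w n \<alpha> *s E n \<alpha>)"
    by (rule sum.mono_neutral_right) (auto simp: w_def)
  finally show ?thesis
    by (simp add: w_def E_def falling_def mult_ac)
qed

end


section \<open>The relations of the Lie algebra in an associative algebra\<close>

locale n52_relations = assoc_algebra scale
  for scale :: "'f::field_char_0 \<Rightarrow> 'a::{ring, monoid_mult} \<Rightarrow> 'a" (infixr "*s" 75) +
  fixes x1 x2 x3 x4 x5 :: 'a
  assumes x43: "x4 * x3 = x3 * x4 - x2"
    and x53: "x5 * x3 = x3 * x5 - x1"
    and x54: "x5 * x4 = x4 * x5 - x3"
    and x21: "x2 * x1 = x1 * x2" and x31: "x3 * x1 = x1 * x3"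
    and x41: "x4 * x1 = x1 * x4" and x51: "x5 * x1 = x1 * x5"
    and x32: "x3 * x2 = x2 * x3" and x42: "x4 * x2 = x2 * x4" and x52: "x5 * x2 = x2 * x5"
begin

lemmas central_commutes = x21 x31 x41 x51 x32 x42 x52

lemmas central_power_commutes = central_commutes[THEN power_commute]

text \<open>Oriented so that rewriting moves \<open>x1\<close> and then \<open>x2\<close> to the front of a product.\<close>

lemma central_power_left_commutes:
  "x2 ^ i * (x1 ^ h * u) = x1 ^ h * (x2 ^ i * u)"
  "x3 ^ i * (x1 ^ h * u) = x1 ^ h * (x3 ^ i * u)"
  "x4 ^ i * (x1 ^ h * u) = x1 ^ h * (x4 ^ i * u)"
  "x5 ^ i * (x1 ^ h * u) = x1 ^ h * (x5 ^ i * u)"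
  "x3 ^ i * (x2 ^ h * u) = x2 ^ h * (x3 ^ i * u)"
  "x4 ^ i * (x2 ^ h * u) = x2 ^ h * (x4 ^ i * u)"
  "x5 ^ i * (x2 ^ h * u) = x2 ^ h * (x5 ^ i * u)"
  by (metis central_power_commutes mult.assoc)+

text \<open>
  Each of the \<open>a\<close> factors \<open>x4\<close> that \<open>x5\<close> passes leaves a summand with \<open>- x3\<close> in its place. Bringing
  that \<open>x3\<close> to the front past the preceding factors \<open>x4\<close> yields an \<open>x2\<close> for each of them,
  \<open>0 + 1 + \<dots> + (a - 1)\<close> altogether.
\<close>

lemma mult_x5_power_x4:
  "x5 * x4 ^ a = x4 ^ a * x5 - of_nat a *s (x3 * x4 ^ (a - 1))
     + of_nat (a choose 2) *s (x2 * x4 ^ (a - 2))"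
proof (induction a)
  case (Suc a)
  have x2: "x4 * (x2 * x4 ^ i) = x2 * x4 ^ Suc i" for i
    by (metis x42 mult.assoc power_Suc)
  have x3: "x4 * (x3 * x4 ^ i) = x3 * x4 ^ Suc i - x2 * x4 ^ i" for i
    by (metis x43 mult.assoc power_Suc left_diff_distrib)
  have "x5 * x4 ^ Suc a = x4 * (x5 * x4 ^ a) - x3 * x4 ^ a"
    using x54 by (simp add: left_diff_distrib flip: mult.assoc)
  also have "\<dots> = x4 ^ Suc a * x5 - of_nat a *s (x4 * (x3 * x4 ^ (a - 1)))
      + of_nat (a choose 2) *s (x4 * (x2 * x4 ^ (a - 2))) - x3 * x4 ^ a"
    by (simp add: Suc algebra_simps)
  also have "of_nat a *s (x4 * (x3 * x4 ^ (a - 1))) = of_nat a *s (x3 * x4 ^ a) - of_nat a *s (x2 * x4 ^ (a - 1))"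
    by (cases a) (simp_all only: x3, simp_all add: scale_right_diff_distrib)
  also have "of_nat (a choose 2) *s (x4 * (x2 * x4 ^ (a - 2))) = of_nat (a choose 2) *s (x2 * x4 ^ (a - 1))"
  proof (cases "a < 2")
    case False
    then obtain c where "a = Suc (Suc c)"
      by (metis add_2_eq_Suc le_Suc_ex not_less)
    then show ?thesis
      by (simp add: x2)
  qed (simp add: binomial_eq_0)
  finally show ?case
    by (simp add: numeral_2_eq_2 algebra_simps)
qed (simp add: binomial_eq_0)

text \<open>
  Here \<open>\<beta>1\<close>, \<open>\<beta>2\<close>, \<open>\<beta>3\<close> are the exponents of \<open>x3\<close>, \<open>x2\<close>, \<open>x1\<close>; the falling factorials count the ways to
  choose, in order, the factors \<open>x4\<close> and \<open>x5\<close> that these consume.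
\<close>

definition coeff54 :: "nat \<Rightarrow> nat \<Rightarrow> nat \<Rightarrow> nat \<Rightarrow> nat \<Rightarrow> 'f"
  where "coeff54 n s \<beta>1 \<beta>2 \<beta>3 = (-1) ^ \<beta>1 * falling s (\<beta>1 + 2 * \<beta>2 + \<beta>3) * falling n (\<beta>1 + \<beta>2 + 2 * \<beta>3)
     / (2 ^ (\<beta>2 + \<beta>3) * fact \<beta>3 * fact \<beta>2 * fact \<beta>1)"

text \<open>
  Multiplication by \<open>x5\<close> from the left sends an ordered monomial to itself with one more \<open>x5\<close> at the
  end, and to three correction terms: an \<open>x4\<close> becomes \<open>- x3\<close> (\<open>\<beta>1\<close> grows), two \<open>x4\<close> become an \<open>x2\<close>
  (\<open>\<beta>2\<close> grows), or an \<open>x3\<close> becomes \<open>- x1\<close> (\<open>\<beta>3\<close> grows and \<open>\<beta>1\<close> drops). On the other side,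
  \<open>falling (Suc n) c = falling n c + c * falling n (c - 1)\<close> for \<open>c = \<beta>1 + \<beta>2 + 2 * \<beta>3\<close>, and the three
  summands of \<open>c\<close> are the contributions of these corrections. The sum runs over the box \<open>{..s}\<^sup>3\<close>
  during the induction; as the coefficients vanish outside the stated index set, this is the same
  sum, but every index can be shifted separately.
\<close>

lemma power_x5_mult_power_x4:
  "x5 ^ n * x4 ^ s =
    (\<Sum>\<beta>\<in>{(\<beta>1, \<beta>2, \<beta>3). \<beta>1 + 2 * \<beta>2 + \<beta>3 \<le> s \<and> \<beta>1 + \<beta>2 + 2 * \<beta>3 \<le> n}. case \<beta> of (\<beta>1, \<beta>2, \<beta>3) \<Rightarrow>
     coeff54 n s \<beta>1 \<beta>2 \<beta>3 *s (x1 ^ \<beta>3 * x2 ^ \<beta>2 * x3 ^ \<beta>1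
       * x4 ^ (s - (\<beta>1 + 2 * \<beta>2 + \<beta>3)) * x5 ^ (n - (\<beta>1 + \<beta>2 + 2 * \<beta>3))))"
proof -
  define w where "w n = coeff54 n s" for n
  define E where "E n \<beta>1 \<beta>2 \<beta>3 =
     x1 ^ \<beta>3 * x2 ^ \<beta>2 * x3 ^ \<beta>1 * x4 ^ (s - (\<beta>1 + 2 * \<beta>2 + \<beta>3)) * x5 ^ (n - (\<beta>1 + \<beta>2 + 2 * \<beta>3))"
    for n \<beta>1 \<beta>2 \<beta>3
  \<comment> \<open>The coefficient with \<open>falling n c\<close> replaced by \<open>falling n (c - 1)\<close>; the truncated difference for
    \<open>c = 0\<close> is harmless because \<open>P\<close> occurs only with the factors \<open>\<beta>1\<close>, \<open>\<beta>2\<close>, \<open>2 * \<beta>3\<close>.\<close>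
  define P :: "nat \<Rightarrow> nat \<Rightarrow> nat \<Rightarrow> nat \<Rightarrow> 'f" where "P n \<beta>1 \<beta>2 \<beta>3 =
     (-1) ^ \<beta>1 * falling s (\<beta>1 + 2 * \<beta>2 + \<beta>3) * falling n (\<beta>1 + \<beta>2 + 2 * \<beta>3 - 1)
     / (2 ^ (\<beta>2 + \<beta>3) * fact \<beta>3 * fact \<beta>2 * fact \<beta>1)" for n \<beta>1 \<beta>2 \<beta>3
  have w_Suc: "w (Suc n) \<beta>1 \<beta>2 \<beta>3 = w n \<beta>1 \<beta>2 \<beta>3 + of_nat \<beta>1 * P n \<beta>1 \<beta>2 \<beta>3
      + of_nat \<beta>2 * P n \<beta>1 \<beta>2 \<beta>3 + of_nat (2 * \<beta>3) * P n \<beta>1 \<beta>2 \<beta>3" for n \<beta>1 \<beta>2 \<beta>3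
    by (simp add: w_def coeff54_def P_def falling_Suc_left add_divide_distrib algebra_simps)
  \<comment> \<open>Each correction, seen at the index it moves to, has the coefficient that \<open>w_Suc\<close> requires.\<close>
  have P1: "of_nat (Suc \<beta>1) * P n (Suc \<beta>1) \<beta>2 \<beta>3
      = - of_nat (s - (\<beta>1 + 2 * \<beta>2 + \<beta>3)) * w n \<beta>1 \<beta>2 \<beta>3" for n \<beta>1 \<beta>2 \<beta>3
    by (simp add: w_def coeff54_def P_def falling_Suc_right field_simps del: of_nat_Suc)
  have P2: "of_nat (Suc \<beta>2) * P n \<beta>1 (Suc \<beta>2) \<beta>3
      = of_nat ((s - (\<beta>1 + 2 * \<beta>2 + \<beta>3)) choose 2) * w n \<beta>1 \<beta>2 \<beta>3" for n \<beta>1 \<beta>2 \<beta>3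
  proof -
    let ?a = "s - (\<beta>1 + 2 * \<beta>2 + \<beta>3)"
    have "(of_nat (?a choose 2) * 2 :: 'f) = falling ?a 2"
      by (simp add: falling_def)
    also have "\<dots> = of_nat ?a * of_nat (?a - 1)"
      by (simp add: numeral_2_eq_2 falling_Suc_right)
    finally have "of_nat (?a choose 2) = (of_nat ?a * of_nat (?a - 1) / 2 :: 'f)"
      by (simp add: field_simps)
    then show ?thesis
      by (simp add: w_def coeff54_def P_def falling_Suc_right field_simps del: of_nat_Suc)
  qed
  have double: "(of_nat (2 * i) :: 'f) = 2 * of_nat i" for i
    by simp
  have P3: "of_nat (2 * Suc \<beta>3) * P n \<beta>1 \<beta>2 (Suc \<beta>3) = - of_nat (Suc \<beta>1) * w n (Suc \<beta>1) \<beta>2 \<beta>3"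
    for n \<beta>1 \<beta>2 \<beta>3
    unfolding double by (simp add: w_def coeff54_def P_def field_simps del: of_nat_Suc)
  have w_0: "w n \<beta>1 \<beta>2 \<beta>3 = 0" if "s < \<beta>1 + 2 * \<beta>2 + \<beta>3 \<or> n < \<beta>1 + \<beta>2 + 2 * \<beta>3" for n \<beta>1 \<beta>2 \<beta>3
    using that by (auto simp: w_def coeff54_def)
  have P_0: "P n \<beta>1 \<beta>2 \<beta>3 = 0" if "s < \<beta>1 + 2 * \<beta>2 + \<beta>3" for n \<beta>1 \<beta>2 \<beta>3
    using that by (auto simp: P_def)
  have x5E: "w n \<beta>1 \<beta>2 \<beta>3 *s (x5 * E n \<beta>1 \<beta>2 \<beta>3) = w n \<beta>1 \<beta>2 \<beta>3 *s E (Suc n) \<beta>1 \<beta>2 \<beta>3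
     + (- of_nat \<beta>1 * w n \<beta>1 \<beta>2 \<beta>3) *s E (Suc n) (\<beta>1 - 1) \<beta>2 (Suc \<beta>3)
     + (of_nat (Suc \<beta>1) * P n (Suc \<beta>1) \<beta>2 \<beta>3) *s E (Suc n) (Suc \<beta>1) \<beta>2 \<beta>3
     + (of_nat (Suc \<beta>2) * P n \<beta>1 (Suc \<beta>2) \<beta>3) *s E (Suc n) \<beta>1 (Suc \<beta>2) \<beta>3" for n \<beta>1 \<beta>2 \<beta>3
  proof (cases "\<beta>1 + 2 * \<beta>2 + \<beta>3 \<le> s \<and> \<beta>1 + \<beta>2 + 2 * \<beta>3 \<le> n")
    case True
    define a where "a = s - (\<beta>1 + 2 * \<beta>2 + \<beta>3)"
    define e where "e = n - (\<beta>1 + \<beta>2 + 2 * \<beta>3)"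
    have "x5 * E n \<beta>1 \<beta>2 \<beta>3 = x1 ^ \<beta>3 * x2 ^ \<beta>2 * ((x5 * x3 ^ \<beta>1) * x4 ^ a) * x5 ^ e"
      using central_power_left_commutes(4,7)[of 1]
      by (simp add: E_def a_def e_def mult.assoc)
    also have "(x5 * x3 ^ \<beta>1) * x4 ^ a
       = x3 ^ \<beta>1 * (x5 * x4 ^ a) - of_nat \<beta>1 *s (x1 * x3 ^ (\<beta>1 - 1) * x4 ^ a)"
      by (simp add: mult_power_commutator[OF x53 x31[symmetric]] left_diff_distrib mult.assoc)
    also have "x3 ^ \<beta>1 * (x5 * x4 ^ a) = x3 ^ \<beta>1 * x4 ^ a * x5 - of_nat a *s (x3 ^ Suc \<beta>1 * x4 ^ (a - 1))
        + of_nat (a choose 2) *s (x2 * x3 ^ \<beta>1 * x4 ^ (a - 2))"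
    proof -
      have "x3 ^ \<beta>1 * (x2 * u) = x2 * (x3 ^ \<beta>1 * u)" for u
        using central_power_left_commutes(5)[of \<beta>1 1] by simp
      then show ?thesis
        by (simp add: mult_x5_power_x4 algebra_simps power_left_merge flip: power_Suc2)
          (metis power_Suc2 mult.assoc power_Suc)
    qed
    also have "x1 ^ \<beta>3 * x2 ^ \<beta>2 * (x3 ^ \<beta>1 * x4 ^ a * x5 - of_nat a *s (x3 ^ Suc \<beta>1 * x4 ^ (a - 1))
        + of_nat (a choose 2) *s (x2 * x3 ^ \<beta>1 * x4 ^ (a - 2))
        - of_nat \<beta>1 *s (x1 * x3 ^ (\<beta>1 - 1) * x4 ^ a)) * x5 ^ e
      = x1 ^ \<beta>3 * x2 ^ \<beta>2 * x3 ^ \<beta>1 * x4 ^ a * x5 ^ Suc e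
        - of_nat a *s (x1 ^ \<beta>3 * x2 ^ \<beta>2 * x3 ^ Suc \<beta>1 * x4 ^ (a - 1) * x5 ^ e)
        + of_nat (a choose 2) *s (x1 ^ \<beta>3 * x2 ^ Suc \<beta>2 * x3 ^ \<beta>1 * x4 ^ (a - 2) * x5 ^ e)
        - of_nat \<beta>1 *s (x1 ^ Suc \<beta>3 * x2 ^ \<beta>2 * x3 ^ (\<beta>1 - 1) * x4 ^ a * x5 ^ e)"
    proof -
      have "x2 ^ \<beta>2 * (x1 * u) = x1 * (x2 ^ \<beta>2 * u)" for u
        using central_power_left_commutes(1)[of \<beta>2 1] by simp
      then show ?thesis
        by (simp only: distrib_left distrib_right left_diff_distrib right_diff_distrib
            scale_mult_left mult_scale_right power_Suc2[of x1] power_Suc2[of x2] power_Suc[of x5] mult.assoc)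
    qed
    also have "x1 ^ \<beta>3 * x2 ^ \<beta>2 * x3 ^ \<beta>1 * x4 ^ a * x5 ^ Suc e = E (Suc n) \<beta>1 \<beta>2 \<beta>3"
      using True by (simp add: E_def a_def e_def Suc_diff_le)
    also have "x1 ^ \<beta>3 * x2 ^ \<beta>2 * x3 ^ Suc \<beta>1 * x4 ^ (a - 1) * x5 ^ e = E (Suc n) (Suc \<beta>1) \<beta>2 \<beta>3"
      by (simp add: E_def a_def e_def)
    also have "x1 ^ \<beta>3 * x2 ^ Suc \<beta>2 * x3 ^ \<beta>1 * x4 ^ (a - 2) * x5 ^ e = E (Suc n) \<beta>1 (Suc \<beta>2) \<beta>3"
      by (simp add: E_def a_def e_def numeral_2_eq_2)
    \<comment> \<open>The factor \<open>of_nat \<beta>1\<close> removes the case \<open>\<beta>1 = 0\<close>, in which \<open>\<beta>1 - 1\<close> is truncated.\<close>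
    also have "of_nat \<beta>1 *s (x1 ^ Suc \<beta>3 * x2 ^ \<beta>2 * x3 ^ (\<beta>1 - 1) * x4 ^ a * x5 ^ e)
        = of_nat \<beta>1 *s E (Suc n) (\<beta>1 - 1) \<beta>2 (Suc \<beta>3)"
      by (cases \<beta>1) (simp_all add: E_def a_def e_def)
    finally have "x5 * E n \<beta>1 \<beta>2 \<beta>3 = E (Suc n) \<beta>1 \<beta>2 \<beta>3 - of_nat a *s E (Suc n) (Suc \<beta>1) \<beta>2 \<beta>3
      + of_nat (a choose 2) *s E (Suc n) \<beta>1 (Suc \<beta>2) \<beta>3
      - of_nat \<beta>1 *s E (Suc n) (\<beta>1 - 1) \<beta>2 (Suc \<beta>3)" .
    then show ?thesis
      unfolding P1 P2 a_def[symmetric]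
      by (simp only: scale_right_distrib scale_right_diff_distrib scale_scale scale_minus_left
          minus_mult_left[symmetric] mult.commute[of "w n \<beta>1 \<beta>2 \<beta>3"])
        (simp add: algebra_simps)
  next
    case False
    then show ?thesis
      unfolding P1 P2 using w_0 by auto
  qed
  have "x5 ^ n * x4 ^ s = (\<Sum>\<beta>1\<le>s. \<Sum>\<beta>2\<le>s. \<Sum>\<beta>3\<le>s. w n \<beta>1 \<beta>2 \<beta>3 *s E n \<beta>1 \<beta>2 \<beta>3)"
  proof (induction n)
    case 0
    have "w 0 \<beta>1 \<beta>2 \<beta>3 *s E 0 \<beta>1 \<beta>2 \<beta>3
        = (if \<beta>3 = 0 then if \<beta>2 = 0 then if \<beta>1 = 0 then x4 ^ s else 0 else 0 else 0)" for \<beta>1 \<beta>2 \<beta>3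
      using w_0[of \<beta>1 \<beta>2 \<beta>3 0] by (auto simp: w_def coeff54_def E_def)
    then show ?case
      by simp
  next
    case (Suc n)
    let ?E = "E (Suc n)"
    have "x5 ^ Suc n * x4 ^ s = (\<Sum>\<beta>1\<le>s. \<Sum>\<beta>2\<le>s. \<Sum>\<beta>3\<le>s. w n \<beta>1 \<beta>2 \<beta>3 *s (x5 * E n \<beta>1 \<beta>2 \<beta>3))"
      by (simp add: mult.assoc Suc sum_distrib_left)
    also have "\<dots> = (\<Sum>\<beta>1\<le>s. \<Sum>\<beta>2\<le>s. \<Sum>\<beta>3\<le>s. w n \<beta>1 \<beta>2 \<beta>3 *s ?E \<beta>1 \<beta>2 \<beta>3)
      + (\<Sum>\<beta>1\<le>s. \<Sum>\<beta>2\<le>s. \<Sum>\<beta>3\<le>s. (- of_nat \<beta>1 * w n \<beta>1 \<beta>2 \<beta>3) *s ?E (\<beta>1 - 1) \<beta>2 (Suc \<beta>3))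
      + (\<Sum>\<beta>1\<le>s. \<Sum>\<beta>2\<le>s. \<Sum>\<beta>3\<le>s. (of_nat (Suc \<beta>1) * P n (Suc \<beta>1) \<beta>2 \<beta>3) *s ?E (Suc \<beta>1) \<beta>2 \<beta>3)
      + (\<Sum>\<beta>1\<le>s. \<Sum>\<beta>2\<le>s. \<Sum>\<beta>3\<le>s. (of_nat (Suc \<beta>2) * P n \<beta>1 (Suc \<beta>2) \<beta>3) *s ?E \<beta>1 (Suc \<beta>2) \<beta>3)"
      unfolding x5E by (simp only: sum.distrib)
    \<comment> \<open>This correction lowers \<open>\<beta>1\<close> and raises \<open>\<beta>3\<close>, which takes one shift in each index.\<close>
    also have "(\<Sum>\<beta>1\<le>s. \<Sum>\<beta>2\<le>s. \<Sum>\<beta>3\<le>s. (- of_nat \<beta>1 * w n \<beta>1 \<beta>2 \<beta>3) *s ?E (\<beta>1 - 1) \<beta>2 (Suc \<beta>3))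
      = (\<Sum>\<beta>1\<le>s. \<Sum>\<beta>2\<le>s. \<Sum>\<beta>3\<le>s.
          (- of_nat (Suc \<beta>1) * w n (Suc \<beta>1) \<beta>2 \<beta>3) *s ?E (Suc \<beta>1 - 1) \<beta>2 (Suc \<beta>3))"
      by (rule sum_shift[symmetric]) (simp_all add: w_0)
    also have "\<dots> = (\<Sum>\<beta>1\<le>s. \<Sum>\<beta>2\<le>s. \<Sum>\<beta>3\<le>s.
          (of_nat (2 * Suc \<beta>3) * P n \<beta>1 \<beta>2 (Suc \<beta>3)) *s ?E \<beta>1 \<beta>2 (Suc \<beta>3))"
      unfolding P3 by simp
    also have "\<dots> = (\<Sum>\<beta>1\<le>s. \<Sum>\<beta>2\<le>s. \<Sum>\<beta>3\<le>s. (of_nat (2 * \<beta>3) * P n \<beta>1 \<beta>2 \<beta>3) *s ?E \<beta>1 \<beta>2 \<beta>3)"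
      by (intro sum.cong refl sum_shift) (simp_all add: P_0)
    also have "(\<Sum>\<beta>1\<le>s. \<Sum>\<beta>2\<le>s. \<Sum>\<beta>3\<le>s. (of_nat (Suc \<beta>1) * P n (Suc \<beta>1) \<beta>2 \<beta>3) *s ?E (Suc \<beta>1) \<beta>2 \<beta>3)
      = (\<Sum>\<beta>1\<le>s. \<Sum>\<beta>2\<le>s. \<Sum>\<beta>3\<le>s. (of_nat \<beta>1 * P n \<beta>1 \<beta>2 \<beta>3) *s ?E \<beta>1 \<beta>2 \<beta>3)"
      by (rule sum_shift) (simp_all add: P_0)
    also have "(\<Sum>\<beta>1\<le>s. \<Sum>\<beta>2\<le>s. \<Sum>\<beta>3\<le>s. (of_nat (Suc \<beta>2) * P n \<beta>1 (Suc \<beta>2) \<beta>3) *s ?E \<beta>1 (Suc \<beta>2) \<beta>3)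
      = (\<Sum>\<beta>1\<le>s. \<Sum>\<beta>2\<le>s. \<Sum>\<beta>3\<le>s. (of_nat \<beta>2 * P n \<beta>1 \<beta>2 \<beta>3) *s ?E \<beta>1 \<beta>2 \<beta>3)"
      by (intro sum.cong refl sum_shift) (simp_all add: P_0)
    finally show ?case
      by (simp add: w_Suc scale_left_distrib sum.distrib)
  qed
  also have "\<dots> = (\<Sum>(\<beta>1, \<beta>2, \<beta>3)\<in>{..s} \<times> {..s} \<times> {..s}. w n \<beta>1 \<beta>2 \<beta>3 *s E n \<beta>1 \<beta>2 \<beta>3)"
    by (simp add: sum.cartesian_product)
  also have "\<dots> = (\<Sum>(\<beta>1, \<beta>2, \<beta>3)\<in>{(\<beta>1, \<beta>2, \<beta>3). \<beta>1 + 2 * \<beta>2 + \<beta>3 \<le> s \<and> \<beta>1 + \<beta>2 + 2 * \<beta>3 \<le> n}.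
      w n \<beta>1 \<beta>2 \<beta>3 *s E n \<beta>1 \<beta>2 \<beta>3)"
    by (rule sum.mono_neutral_right) (auto intro!: w_0 simp flip: not_le)
  finally show ?thesis
    by (simp add: w_def E_def)
qed

text \<open>
  The order of the reorderings matters: \<open>x4 ^ m\<close> is moved past \<open>x3\<close> last, because moving \<open>x5\<close> past
  \<open>x4 ^ s\<close> produces further factors \<open>x3\<close>.
\<close>

lemma ordered_monomial_product:
  "(x1 ^ j * x2 ^ k * x3 ^ l * x4 ^ m * x5 ^ n) * (x1 ^ p * x2 ^ q * x3 ^ r * x4 ^ s * x5 ^ t) =
   (\<Sum>\<alpha>\<in>{0..min n r}.
    \<Sum>\<beta>\<in>{(\<beta>1, \<beta>2, \<beta>3). \<beta>1 + 2 * \<beta>2 + \<beta>3 \<le> s \<and> \<beta>1 + \<beta>2 + 2 * \<beta>3 \<le> n - \<alpha>}.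
    case \<beta> of (\<beta>1, \<beta>2, \<beta>3) \<Rightarrow>
    \<Sum>\<gamma>\<in>{0..min m (r - \<alpha> + \<beta>1)}.
      (of_nat (n choose \<alpha>) * of_nat (r choose \<alpha>)
        * of_nat (s choose (\<beta>1 + 2 * \<beta>2 + \<beta>3)) * of_nat ((n - \<alpha>) choose (\<beta>1 + \<beta>2 + 2 * \<beta>3))
        * of_nat (m choose \<gamma>) * of_nat ((r - \<alpha> + \<beta>1) choose \<gamma>)
        * (fact (\<beta>1 + 2 * \<beta>2 + \<beta>3) * fact (\<beta>1 + \<beta>2 + 2 * \<beta>3)
           / (2 ^ (\<beta>2 + \<beta>3) * fact \<beta>3 * fact \<beta>2 * fact \<beta>1))
        * (-1) ^ (\<alpha> + \<beta>1 + \<gamma>) * fact \<alpha> * fact \<gamma>)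
      *s (x1 ^ (j + p + \<alpha> + \<beta>3) * x2 ^ (k + q + \<beta>2 + \<gamma>) * x3 ^ (l + r - \<alpha> + \<beta>1 - \<gamma>)
          * x4 ^ (m + s - \<gamma> - \<beta>1 - 2 * \<beta>2 - \<beta>3) * x5 ^ (n + t - \<alpha> - \<beta>1 - \<beta>2 - 2 * \<beta>3)))"
proof -
  define a :: "nat \<Rightarrow> nat \<Rightarrow> nat \<Rightarrow> 'f"
    where "a n r \<alpha> = of_nat (n choose \<alpha>) * of_nat (r choose \<alpha>) * (-1) ^ \<alpha> * fact \<alpha>" for n r \<alpha>
  note reorder = mult.assoc central_power_left_commutes power_left_merge power_add[symmetric]
    add.assoc add.commute add.left_commute
  have x53s: "x5 ^ n * x3 ^ r = (\<Sum>\<alpha>\<in>{0..min n r}. a n r \<alpha> *s (x1 ^ \<alpha> * x3 ^ (r - \<alpha>) * x5 ^ (n - \<alpha>)))"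
    unfolding a_def by (rule power_mult_power_commutator) (simp_all add: x53 x31 x51)
  have x43s: "x4 ^ m * x3 ^ i = (\<Sum>\<gamma>\<in>{0..min m i}. a m i \<gamma> *s (x2 ^ \<gamma> * x3 ^ (i - \<gamma>) * x4 ^ (m - \<gamma>)))" for i
    unfolding a_def by (rule power_mult_power_commutator) (simp_all add: x43 x32 x42)
  have "(x1 ^ j * x2 ^ k * x3 ^ l * x4 ^ m * x5 ^ n) * (x1 ^ p * x2 ^ q * x3 ^ r * x4 ^ s * x5 ^ t)
    = x1 ^ (j + p) * x2 ^ (k + q) * x3 ^ l * x4 ^ m * (x5 ^ n * x3 ^ r) * x4 ^ s * x5 ^ t"
    by (simp only: reorder)
  also have "\<dots> = (\<Sum>\<alpha>\<in>{0..min n r}. a n r \<alpha> *s (x1 ^ (j + p + \<alpha>) * x2 ^ (k + q) * x3 ^ l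
      * (x4 ^ m * x3 ^ (r - \<alpha>)) * (x5 ^ (n - \<alpha>) * x4 ^ s) * x5 ^ t))"
    by (simp only: x53s sum_distrib_left sum_distrib_right scale_mult_left mult_scale_right reorder)
  also have "\<dots> = (\<Sum>\<alpha>\<in>{0..min n r}.
    \<Sum>\<beta>\<in>{(\<beta>1, \<beta>2, \<beta>3). \<beta>1 + 2 * \<beta>2 + \<beta>3 \<le> s \<and> \<beta>1 + \<beta>2 + 2 * \<beta>3 \<le> n - \<alpha>}.
    case \<beta> of (\<beta>1, \<beta>2, \<beta>3) \<Rightarrow> (a n r \<alpha> * coeff54 (n - \<alpha>) s \<beta>1 \<beta>2 \<beta>3) *s
      (x1 ^ (j + p + \<alpha> + \<beta>3) * x2 ^ (k + q + \<beta>2) * x3 ^ l * (x4 ^ m * x3 ^ (r - \<alpha> + \<beta>1))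
       * x4 ^ (s - (\<beta>1 + 2 * \<beta>2 + \<beta>3)) * x5 ^ (n - \<alpha> - (\<beta>1 + \<beta>2 + 2 * \<beta>3) + t)))"
    by (simp only: power_x5_mult_power_x4 sum_distrib_left sum_distrib_right scale_sum_right
        scale_mult_left mult_scale_right scale_scale reorder split_def)
  also have "\<dots> = (\<Sum>\<alpha>\<in>{0..min n r}.
    \<Sum>\<beta>\<in>{(\<beta>1, \<beta>2, \<beta>3). \<beta>1 + 2 * \<beta>2 + \<beta>3 \<le> s \<and> \<beta>1 + \<beta>2 + 2 * \<beta>3 \<le> n - \<alpha>}.
    case \<beta> of (\<beta>1, \<beta>2, \<beta>3) \<Rightarrow> \<Sum>\<gamma>\<in>{0..min m (r - \<alpha> + \<beta>1)}.
      (a n r \<alpha> * coeff54 (n - \<alpha>) s \<beta>1 \<beta>2 \<beta>3 * a m (r - \<alpha> + \<beta>1) \<gamma>) *s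
      (x1 ^ (j + p + \<alpha> + \<beta>3) * x2 ^ (k + q + \<beta>2 + \<gamma>) * x3 ^ (l + (r - \<alpha> + \<beta>1 - \<gamma>))
       * x4 ^ (m - \<gamma> + (s - (\<beta>1 + 2 * \<beta>2 + \<beta>3))) * x5 ^ (n - \<alpha> - (\<beta>1 + \<beta>2 + 2 * \<beta>3) + t)))"
    by (simp only: x43s sum_distrib_left sum_distrib_right scale_sum_right
        scale_mult_left mult_scale_right scale_scale reorder)
  also have "\<dots> = (\<Sum>\<alpha>\<in>{0..min n r}.
    \<Sum>\<beta>\<in>{(\<beta>1, \<beta>2, \<beta>3). \<beta>1 + 2 * \<beta>2 + \<beta>3 \<le> s \<and> \<beta>1 + \<beta>2 + 2 * \<beta>3 \<le> n - \<alpha>}.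
    case \<beta> of (\<beta>1, \<beta>2, \<beta>3) \<Rightarrow>
    \<Sum>\<gamma>\<in>{0..min m (r - \<alpha> + \<beta>1)}.
      (of_nat (n choose \<alpha>) * of_nat (r choose \<alpha>)
        * of_nat (s choose (\<beta>1 + 2 * \<beta>2 + \<beta>3)) * of_nat ((n - \<alpha>) choose (\<beta>1 + \<beta>2 + 2 * \<beta>3))
        * of_nat (m choose \<gamma>) * of_nat ((r - \<alpha> + \<beta>1) choose \<gamma>)
        * (fact (\<beta>1 + 2 * \<beta>2 + \<beta>3) * fact (\<beta>1 + \<beta>2 + 2 * \<beta>3)
           / (2 ^ (\<beta>2 + \<beta>3) * fact \<beta>3 * fact \<beta>2 * fact \<beta>1))
        * (-1) ^ (\<alpha> + \<beta>1 + \<gamma>) * fact \<alpha> * fact \<gamma>)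
      *s (x1 ^ (j + p + \<alpha> + \<beta>3) * x2 ^ (k + q + \<beta>2 + \<gamma>) * x3 ^ (l + r - \<alpha> + \<beta>1 - \<gamma>)
          * x4 ^ (m + s - \<gamma> - \<beta>1 - 2 * \<beta>2 - \<beta>3) * x5 ^ (n + t - \<alpha> - \<beta>1 - \<beta>2 - 2 * \<beta>3)))"
    (is "(\<Sum>\<alpha>\<in>?A. \<Sum>\<beta>\<in>?B \<alpha>. case \<beta> of (\<beta>1, \<beta>2, \<beta>3) \<Rightarrow>
          \<Sum>\<gamma>\<in>?C \<alpha> \<beta>1. ?c \<alpha> \<beta>1 \<beta>2 \<beta>3 \<gamma> *s ?x \<alpha> \<beta>1 \<beta>2 \<beta>3 \<gamma>) =
        (\<Sum>\<alpha>\<in>?A. \<Sum>\<beta>\<in>?B \<alpha>. case \<beta> of (\<beta>1, \<beta>2, \<beta>3) \<Rightarrow>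
          \<Sum>\<gamma>\<in>?C \<alpha> \<beta>1. ?d \<alpha> \<beta>1 \<beta>2 \<beta>3 \<gamma> *s ?y \<alpha> \<beta>1 \<beta>2 \<beta>3 \<gamma>)")
  proof (intro sum.cong refl)
    fix \<alpha> \<beta>
    assume \<alpha>: "\<alpha> \<in> {0..min n r}"
      and \<beta>: "\<beta> \<in> {(\<beta>1, \<beta>2, \<beta>3). \<beta>1 + 2 * \<beta>2 + \<beta>3 \<le> s \<and> \<beta>1 + \<beta>2 + 2 * \<beta>3 \<le> n - \<alpha>}"
    obtain \<beta>1 \<beta>2 \<beta>3 where eq: "\<beta> = (\<beta>1, \<beta>2, \<beta>3)"
      using prod_cases3 by blast
    have \<alpha>\<beta>: "\<alpha> \<le> n" "\<alpha> \<le> r" "\<beta>1 + 2 * \<beta>2 + \<beta>3 \<le> s" "\<beta>1 + \<beta>2 + 2 * \<beta>3 \<le> n - \<alpha>"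
      using \<alpha> \<beta> by (simp_all only: eq mem_Collect_eq prod.case atLeastAtMost_iff min.bounded_iff)
    show "(case \<beta> of (\<beta>1, \<beta>2, \<beta>3) \<Rightarrow> \<Sum>\<gamma>\<in>?C \<alpha> \<beta>1. ?c \<alpha> \<beta>1 \<beta>2 \<beta>3 \<gamma> *s ?x \<alpha> \<beta>1 \<beta>2 \<beta>3 \<gamma>) =
        (case \<beta> of (\<beta>1, \<beta>2, \<beta>3) \<Rightarrow> \<Sum>\<gamma>\<in>?C \<alpha> \<beta>1. ?d \<alpha> \<beta>1 \<beta>2 \<beta>3 \<gamma> *s ?y \<alpha> \<beta>1 \<beta>2 \<beta>3 \<gamma>)"
      unfolding eq prod.case
    proof (rule sum.cong[OF refl], rule arg_cong2[where f = scale])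
      fix \<gamma>
      assume \<gamma>: "\<gamma> \<in> {0..min m (r - \<alpha> + \<beta>1)}"
      have "\<gamma> \<le> m" "\<gamma> \<le> r - \<alpha> + \<beta>1"
        using \<gamma> by simp_all
      have "l + (r - \<alpha> + \<beta>1 - \<gamma>) = l + r - \<alpha> + \<beta>1 - \<gamma>"
        using \<open>\<alpha> \<le> r\<close> \<open>\<gamma> \<le> r - \<alpha> + \<beta>1\<close> by simp
      moreover have "m - \<gamma> + (s - (\<beta>1 + 2 * \<beta>2 + \<beta>3)) = m + s - \<gamma> - \<beta>1 - 2 * \<beta>2 - \<beta>3"
        using \<open>\<gamma> \<le> m\<close> \<alpha>\<beta>(3) by simp
      moreover have "n - \<alpha> - (\<beta>1 + \<beta>2 + 2 * \<beta>3) + t = n + t - \<alpha> - \<beta>1 - \<beta>2 - 2 * \<beta>3"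
        using \<alpha>\<beta>(1,4) by simp
      ultimately show "?x \<alpha> \<beta>1 \<beta>2 \<beta>3 \<gamma> = ?y \<alpha> \<beta>1 \<beta>2 \<beta>3 \<gamma>"
        by (simp only:)
      show "?c \<alpha> \<beta>1 \<beta>2 \<beta>3 \<gamma> = ?d \<alpha> \<beta>1 \<beta>2 \<beta>3 \<gamma>"
        by (simp only: a_def coeff54_def falling_def power_add times_divide_eq_left times_divide_eq_right
            mult_ac)
    qed
  qed
  finally show ?thesis .
qed

end

section \<open>The product of all enveloping algebras as a type\<close>

lemma free_scalar_add: "free_scalar (c + d) = free_scalar c + free_scalar d"
  by (simp add: free_scalar_def single_add)

lemma free_scalar_mult: "free_scalar (c * d) = free_scalar c * free_scalar d"
  by (simp add: free_scalar_def mult_single)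

lemma free_scalar_central: "a * free_scalar c = free_scalar c * a"
  by (induction a rule: free_alg_induct)
    (simp_all add: free_scalar_def mult_single mult.commute distrib_left distrib_right)

text \<open>
  A type cannot depend on the scalar multiplication and the bracket of a theorem, so a single
  enveloping algebra has no type of its own. The product of the enveloping algebras for all possible
  values of these two operations has one; it is meaningful since \<open>UEA\<close> is a ring for arbitrary
  arguments.
\<close>

typedef (overloaded) ('f::field, 'l::ab_group_add) uea_family =
  "{F :: ('f \<Rightarrow> 'l \<Rightarrow> 'l) \<Rightarrow> ('l \<Rightarrow> 'l \<Rightarrow> 'l) \<Rightarrow> ('f, 'l) free_alg set.
     \<forall>scale bracket. F scale bracket \<in> carrier (UEA scale bracket)}"
  by (auto intro!: exI[of _ "\<lambda>scale bracket. uea_class scale bracket 0"] simp: carrier_UEA)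

interpretation uea: ring "UEA scale bracket" for scale bracket
  by (rule ring_UEA)

setup_lifting type_definition_uea_family

instantiation uea_family :: (field, ab_group_add) "{ring, monoid_mult}"
begin

lift_definition zero_uea_family :: "('a, 'b) uea_family" is "\<lambda>s b. \<zero>\<^bsub>UEA s b\<^esub>"
  by simp

lift_definition one_uea_family :: "('a, 'b) uea_family" is "\<lambda>s b. \<one>\<^bsub>UEA s b\<^esub>"
  by simp

lift_definition plus_uea_family :: "('a, 'b) uea_family \<Rightarrow> ('a, 'b) uea_family \<Rightarrow> ('a, 'b) uea_family"
  is "\<lambda>F G s b. F s b \<oplus>\<^bsub>UEA s b\<^esub> G s b"
  by simp

lift_definition times_uea_family :: "('a, 'b) uea_family \<Rightarrow> ('a, 'b) uea_family \<Rightarrow> ('a, 'b) uea_family"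
  is "\<lambda>F G s b. F s b \<otimes>\<^bsub>UEA s b\<^esub> G s b"
  by simp

lift_definition uminus_uea_family :: "('a, 'b) uea_family \<Rightarrow> ('a, 'b) uea_family"
  is "\<lambda>F s b. \<ominus>\<^bsub>UEA s b\<^esub> F s b"
  by simp

lift_definition minus_uea_family :: "('a, 'b) uea_family \<Rightarrow> ('a, 'b) uea_family \<Rightarrow> ('a, 'b) uea_family"
  is "\<lambda>F G s b. F s b \<ominus>\<^bsub>UEA s b\<^esub> G s b"
  by simp

instance
proof
  fix F G H :: "('a, 'b) uea_family"
  show "F + G + H = F + (G + H)"
    by transfer (simp add: uea.a_assoc)
  show "F + G = G + F"
    by transfer (simp add: uea.a_comm)
  show "0 + F = F"
    by transfer (simp add: uea.l_zero)
  show "- F + F = 0"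
    by transfer (simp add: uea.l_neg)
  show "F - G = F + - G"
    by transfer (simp add: a_minus_def)
  show "F * G * H = F * (G * H)"
    by transfer (simp add: uea.m_assoc)
  show "(F + G) * H = F * H + G * H"
    by transfer (simp add: uea.l_distr)
  show "F * (G + H) = F * G + F * H"
    by transfer (simp add: uea.r_distr)
  show "1 * F = F"
    by transfer (simp add: uea.l_one)
  show "F * 1 = F"
    by transfer simp
qed

end

lemma UEA_smult_closed: "u \<in> carrier (UEA s b) \<Longrightarrow> c \<odot>\<^bsub>UEA s b\<^esub> u \<in> carrier (UEA s b)"
  by (auto simp: carrier_UEA UEA_simps)

lift_definition family_scale :: "'f::field \<Rightarrow> ('f, 'l::ab_group_add) uea_family \<Rightarrow> ('f, 'l) uea_family"
  is "\<lambda>c F s b. c \<odot>\<^bsub>UEA s b\<^esub> F s b"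
  by (simp add: UEA_smult_closed)

lemma UEA_smult_mult:
  assumes "u \<in> carrier (UEA s b)" and "v \<in> carrier (UEA s b)"
  shows "c \<odot>\<^bsub>UEA s b\<^esub> (u \<oplus>\<^bsub>UEA s b\<^esub> v) = c \<odot>\<^bsub>UEA s b\<^esub> u \<oplus>\<^bsub>UEA s b\<^esub> c \<odot>\<^bsub>UEA s b\<^esub> v"
    and "(c \<odot>\<^bsub>UEA s b\<^esub> u) \<otimes>\<^bsub>UEA s b\<^esub> v = c \<odot>\<^bsub>UEA s b\<^esub> (u \<otimes>\<^bsub>UEA s b\<^esub> v)"
    and "u \<otimes>\<^bsub>UEA s b\<^esub> (c \<odot>\<^bsub>UEA s b\<^esub> v) = c \<odot>\<^bsub>UEA s b\<^esub> (u \<otimes>\<^bsub>UEA s b\<^esub> v)"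
proof -
  obtain f g where fg: "u = uea_class s b f" "v = uea_class s b g"
    using assms by (auto simp: carrier_UEA)
  have "f * (free_scalar c * g) = free_scalar c * (f * g)"
    by (simp add: free_scalar_central flip: mult.assoc)
  then show "u \<otimes>\<^bsub>UEA s b\<^esub> (c \<odot>\<^bsub>UEA s b\<^esub> v) = c \<odot>\<^bsub>UEA s b\<^esub> (u \<otimes>\<^bsub>UEA s b\<^esub> v)"
    by (simp add: fg UEA_simps)
qed (use assms in \<open>auto simp: carrier_UEA UEA_simps distrib_left mult.assoc\<close>)

lemma UEA_smult_scalar:
  assumes "u \<in> carrier (UEA s b)"
  shows "(c + d) \<odot>\<^bsub>UEA s b\<^esub> u = c \<odot>\<^bsub>UEA s b\<^esub> u \<oplus>\<^bsub>UEA s b\<^esub> d \<odot>\<^bsub>UEA s b\<^esub> u"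
    and "c \<odot>\<^bsub>UEA s b\<^esub> (d \<odot>\<^bsub>UEA s b\<^esub> u) = (c * d) \<odot>\<^bsub>UEA s b\<^esub> u"
    and "1 \<odot>\<^bsub>UEA s b\<^esub> u = u"
  using assms
  by (auto simp: carrier_UEA UEA_simps free_scalar_add free_scalar_mult distrib_right mult.assoc
      free_scalar_def[of 1])

lemma assoc_algebra_family_scale:
  "assoc_algebra (family_scale :: 'f::field_char_0 \<Rightarrow> ('f, 'l::ab_group_add) uea_family \<Rightarrow> _)"
proof
  fix c d :: 'f and F G :: "('f, 'l) uea_family"
  show "family_scale c (F + G) = family_scale c F + family_scale c G"
    by transfer (simp add: UEA_smult_mult(1))
  show "family_scale (c + d) F = family_scale c F + family_scale d F"
    by transfer (simp add: UEA_smult_scalar(1))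
  show "family_scale c (family_scale d F) = family_scale (c * d) F"
    by transfer (simp add: UEA_smult_scalar(2))
  show "family_scale 1 F = F"
    by transfer (simp add: UEA_smult_scalar(3))
  show "family_scale c F * G = family_scale c (F * G)"
    by transfer (simp add: UEA_smult_mult(2))
  show "F * family_scale c G = family_scale c (F * G)"
    by transfer (simp add: UEA_smult_mult(3))
qed

definition component ::
    "('f::field \<Rightarrow> 'l::ab_group_add \<Rightarrow> 'l) \<Rightarrow> ('l \<Rightarrow> 'l \<Rightarrow> 'l) \<Rightarrow> ('f, 'l) uea_family \<Rightarrow> ('f, 'l) free_alg set"
  where "component s b F = Rep_uea_family F s b"

lemma component_closed [simp]: "component s b F \<in> carrier (UEA s b)"
  using Rep_uea_family[of F] by (simp add: component_def)

lemma component_mult: "component s b (F * G) = component s b F \<otimes>\<^bsub>UEA s b\<^esub> component s b G"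
  by (simp add: component_def times_uea_family.rep_eq)

lemma component_add: "component s b (F + G) = component s b F \<oplus>\<^bsub>UEA s b\<^esub> component s b G"
  by (simp add: component_def plus_uea_family.rep_eq)

lemma component_diff: "component s b (F - G) = component s b F \<ominus>\<^bsub>UEA s b\<^esub> component s b G"
  by (simp add: component_def minus_uea_family.rep_eq)

lemma component_scale: "component s b (family_scale c F) = c \<odot>\<^bsub>UEA s b\<^esub> component s b F"
  by (simp add: component_def family_scale.rep_eq)

lemma component_power: "component s b (F ^ i) = component s b F [^]\<^bsub>UEA s b\<^esub> i"
proof (induction i)
  case 0
  have "component s b 1 = \<one>\<^bsub>UEA s b\<^esub>"
    by (simp add: component_def one_uea_family.rep_eq)
  then show ?case
    by simp
next
  case (Suc i)
  then show ?case
    by (simp add: power_Suc2 component_mult del: power_Suc)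
qed

lemma component_sum: "component s b (sum f A) = finsum (UEA s b) (\<lambda>i. component s b (f i)) A"
proof -
  have zero: "component s b 0 = \<zero>\<^bsub>UEA s b\<^esub>"
    by (simp add: component_def zero_uea_family.rep_eq)
  show ?thesis
  proof (induction A rule: infinite_finite_induct)
    case (insert a A)
    then show ?case
      by (simp add: component_add)
  qed (simp_all add: zero)
qed

lemma uea_family_eqI: "(\<And>s b. component s b F = component s b G) \<Longrightarrow> F = G"
  unfolding component_def Rep_uea_family_inject[symmetric] by (rule ext)+

text \<open>
  Zero is a safe value at the other components: it satisfies every relation of the basis, while the
  images of the basis elements satisfy them only for the bracket at hand.
\<close>

lift_definition family_incl ::
    "('f::field \<Rightarrow> 'l::ab_group_add \<Rightarrow> 'l) \<Rightarrow> ('l \<Rightarrow> 'l \<Rightarrow> 'l) \<Rightarrow> 'l \<Rightarrow> ('f, 'l) uea_family"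
  is "\<lambda>scale bracket v s b. if s = scale \<and> b = bracket then uea_incl s b v else \<zero>\<^bsub>UEA s b\<^esub>"
  by (simp add: UEA_simps carrier_UEA)

lemma component_incl:
  "component s b (family_incl scale bracket v) =
     (if s = scale \<and> b = bracket then uea_incl s b v else \<zero>\<^bsub>UEA s b\<^esub>)"
  by (simp add: component_def family_incl.rep_eq)

lemma family_incl_add: "family_incl s b (v + w) = family_incl s b v + family_incl s b w"
  by (rule uea_family_eqI) (simp add: component_add component_incl uea_incl_add)

lemma family_incl_bracket:
  "family_incl s b (b v w) = family_incl s b v * family_incl s b w - family_incl s b w * family_incl s b v"
  by (rule uea_family_eqI)
    (simp add: component_diff component_mult component_incl uea_incl_bracket[of s b v w] a_minus_def)

lemma n52_relations_family_incl:
  fixes scale :: "'f::field_char_0 \<Rightarrow> 'l::ab_group_add \<Rightarrow> 'l"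
  assumes "lie_algebra_n52 scale bracket x"
  defines "e \<equiv> \<lambda>i. family_incl scale bracket (x i)"
  shows "n52_relations family_scale (e 1) (e 2) (e 3) (e 4) (e 5)"
proof -
  interpret lie_algebra_n52 scale bracket x
    by (rule assms(1))
  interpret incl: additive "family_incl scale bracket"
    by standard (rule family_incl_add)
  have commutator: "e i * e j = e j * e i + family_incl scale bracket (bracket (x i) (x j))" for i j
    by (simp add: e_def family_incl_bracket)
  have commute: "e i * e j = e j * e i" if "1 \<le> j" "j < i" "i \<le> 5" "(i, j) \<notin> {(4, 3), (5, 3), (5, 4)}" for i j
    using commutator[of i j] bracket_other[OF that] by (simp add: incl.zero)
  have "e 4 * e 3 = e 3 * e 4 - e 2" "e 5 * e 3 = e 3 * e 5 - e 1" "e 5 * e 4 = e 4 * e 5 - e 3"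
    using commutator[of 4 3] commutator[of 5 3] commutator[of 5 4]
    unfolding bracket_43 bracket_53 bracket_54 incl.minus by (simp_all add: e_def)
  then show ?thesis
    by (intro n52_relations.intro n52_relations_axioms.intro assoc_algebra_family_scale commute) simp_all
qed


section \<open>The product of ordered monomials in the enveloping algebra\<close>

theorem theorem4p6:
  fixes scale :: "'f::real_or_complex \<Rightarrow> 'l::ab_group_add \<Rightarrow> 'l"
    and bracket :: "'l \<Rightarrow> 'l \<Rightarrow> 'l"
    and x :: "nat \<Rightarrow> 'l"
    and U (structure)
    and y :: "nat \<Rightarrow> ('f, 'l) free_alg set"
    and j k l m n p q r s t :: nat
  assumes "lie_algebra_n52 scale bracket x"
    and "U = UEA scale bracket"
    and "y = (\<lambda>i. uea_incl scale bracket (x i))"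
  shows
    "(y 1 [^] j \<otimes> y 2 [^] k \<otimes> y 3 [^] l \<otimes> y 4 [^] m \<otimes> y 5 [^] n) \<otimes>
     (y 1 [^] p \<otimes> y 2 [^] q \<otimes> y 3 [^] r \<otimes> y 4 [^] s \<otimes> y 5 [^] t) =
     (\<Oplus>\<alpha>\<in>{0..min n r}.
      \<Oplus>\<beta>\<in>{(\<beta>\<^sub>1, \<beta>\<^sub>2, \<beta>\<^sub>3). \<beta>\<^sub>1 + 2 * \<beta>\<^sub>2 + \<beta>\<^sub>3 \<le> s \<and> \<beta>\<^sub>1 + \<beta>\<^sub>2 + 2 * \<beta>\<^sub>3 \<le> n - \<alpha>}.
      case \<beta> of (\<beta>\<^sub>1, \<beta>\<^sub>2, \<beta>\<^sub>3) \<Rightarrow>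
      \<Oplus>\<gamma>\<in>{0..min m (r - \<alpha> + \<beta>\<^sub>1)}.
        (of_nat (n choose \<alpha>) * of_nat (r choose \<alpha>)
          * of_nat (s choose (\<beta>\<^sub>1 + 2 * \<beta>\<^sub>2 + \<beta>\<^sub>3))
          * of_nat ((n - \<alpha>) choose (\<beta>\<^sub>1 + \<beta>\<^sub>2 + 2 * \<beta>\<^sub>3))
          * of_nat (m choose \<gamma>) * of_nat ((r - \<alpha> + \<beta>\<^sub>1) choose \<gamma>)
          * (fact (\<beta>\<^sub>1 + 2 * \<beta>\<^sub>2 + \<beta>\<^sub>3) * fact (\<beta>\<^sub>1 + \<beta>\<^sub>2 + 2 * \<beta>\<^sub>3)
             / (2 ^ (\<beta>\<^sub>2 + \<beta>\<^sub>3) * fact \<beta>\<^sub>3 * fact \<beta>\<^sub>2 * fact \<beta>\<^sub>1))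
          * (-1) ^ (\<alpha> + \<beta>\<^sub>1 + \<gamma>) * fact \<alpha> * fact \<gamma> :: 'f) \<odot>
        (y 1 [^] (j + p + \<alpha> + \<beta>\<^sub>3)
          \<otimes> y 2 [^] (k + q + \<beta>\<^sub>2 + \<gamma>)
          \<otimes> y 3 [^] (l + r - \<alpha> + \<beta>\<^sub>1 - \<gamma>)
          \<otimes> y 4 [^] (m + s - \<gamma> - \<beta>\<^sub>1 - 2 * \<beta>\<^sub>2 - \<beta>\<^sub>3)
          \<otimes> y 5 [^] (n + t - \<alpha> - \<beta>\<^sub>1 - \<beta>\<^sub>2 - 2 * \<beta>\<^sub>3)))"
proof -
  let ?e = "\<lambda>i. family_incl scale bracket (x i)"
  interpret n52_relations family_scale "?e 1" "?e 2" "?e 3" "?e 4" "?e 5"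
    by (rule n52_relations_family_incl) (rule assms(1))
  show ?thesis
    using arg_cong[OF ordered_monomial_product[of j k l m n p q r s t], of "component scale bracket"]
    unfolding assms(2,3)
    by (simp only: component_mult component_power component_sum component_scale component_incl
        simp_thms if_True prod.case_distrib[of "component scale bracket"])
qed

end
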